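(* Consider a periodic sampling schedule with period $h$ characterized by $j$ intervals $\mathcal{T}=(\tau_0,\dots,\tau_{j-1})$ (positive integers with sum $h$). Given any two indices $i,l\in\{0,\dots,j-1\}$ with $\tau_i>\tau_l$, and any $p\in\{0,\dots,\lfloor(\tau_i-\tau_l)/2\rfloor\}$, let $\bar{\mathcal{T}}=(\bar\tau_0,\dots,\bar\tau_{j-1})$ be given by $$\bar\tau_\ell=\begin{cases}\tau_i-p,&\ell=i,\\ \tau_l+p,&\ell=l,\\ \tau_\ell,&\text{otherwise.}\end{cases}$$ Then $\bar{\mathcal{T}}$ is superior to $\mathcal{T}$ in the $h_2$ sense, i.e. $J_2(\bar{\mathcal{T}})\le J_2(\mathcal{T})$.
   Context: System: $x_{t+1}=Ax_t+Bu_t+w_t$, $t\in\mathbb{N}_0$, with output $z_t=C_2x_t+D_{21}u_t$, where $x_t,w_t\in\mathbb{R}^{n_x}$, $u_t\in\mathbb{R}^{n_u}$, $C_2^\top D_{21}=0$, $Q:=C_2^\top C_2$, $R:=D_{21}^\top D_{21}>0$, $(A,B)$ controllable and $(A,C_2)$ observable. The initial state $x_0$ is fixed. The $w_t$ are independent, identically distributed, zero-mean random vectors with $\mathbb{E}[w_tw_t^\top]=W\ge 0$. Schedule: a tuple $(\tau_0,\dots,\tau_{j-1})$ of positive integers is extended periodically by $\tau_{\ell+j}=\tau_\ell$; the sampling times are $s_0=0$, $s_{\ell+1}=s_\ell+\tau_\ell$; $\sigma_t=1$ if $t$ is a sampling time and $\sigma_t=0$ otherwise. At time $t$ the controller knows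 $\mathcal{J}_t=\{x_r: 0\le r\le t,\ \sigma_r=1\}$, and a control policy is a sequence of functions $\mu_{u,t}$ with $u_t=\mu_{u,t}(\mathcal{J}_t)$. Cost: $J_2(\mathcal{T})$ denotes the minimal value over control policies of $\lim_{T\to\infty}\frac1T\mathbb{E}[\sum_{t=0}^{T-1}\|z_t\|^2]$ under the schedule $\mathcal{T}$. It equals $\operatorname{tr}(PW)+\frac1h\sum_{\ell=0}^{j-1}\beta(\tau_\ell)$ with $h=\sum_\ell\tau_\ell$, where $P$ is the unique positive definite solution of $P=A^\top PA+Q-A^\top PB(R+B^\top PB)^{-1}B^\top PA$, $Z=A^\top PB(B^\top PB+R)^{-1}B^\top PA$, $\beta(1)=0$, and $\beta(p)=\operatorname{tr}\big(Z\sum_{s=1}^{p-1}\sum_{r=0}^{s-1}A^rW(A^\top)^r\big)$ for $p>1$. *)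

theory Defs
  imports "HOL-Probability.Probability"
begin

definition positive_definite :: "real^'n^'n \<Rightarrow> bool" where
  "positive_definite S \<longleftrightarrow> transpose S = S \<and> (\<forall>v. v \<noteq> 0 \<longrightarrow> 0 < v \<bullet> (S *v v))"

definition positive_semidefinite :: "real^'n^'n \<Rightarrow> bool" where
  "positive_semidefinite S \<longleftrightarrow> transpose S = S \<and> (\<forall>v. 0 \<le> v \<bullet> (S *v v))"

primrec noiseless_state ::
  "real^'n^'n \<Rightarrow> real^'m^'n \<Rightarrow> real^'n \<Rightarrow> (nat \<Rightarrow> real^'m) \<Rightarrow> nat \<Rightarrow> real^'n" where
  "noiseless_state A B x0 u 0 = x0"
| "noiseless_state A B x0 u (Suc t) = A *v noiseless_state A B x0 u t + B *v u t"

text \<open>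
  Every state can be steered to every other state in finitely many steps. Since the origin
  is a possible start, this is the usual rank condition on \<open>[B, AB, \<dots>]\<close>, and not merely
  the weaker controllability to the origin.
\<close>

definition controllable :: "real^'n^'n \<Rightarrow> real^'m^'n \<Rightarrow> bool" where
  "controllable A B \<longleftrightarrow> (\<forall>x0 x1. \<exists>N u. noiseless_state A B x0 u N = x1)"

text \<open>
  The initial state is determined by the output of the unforced system. Powers of \<open>A\<close> are
  written as iterated maps.
\<close>

definition observable :: "real^'n^'n \<Rightarrow> real^'n^'k \<Rightarrow> bool" where
  "observable A C \<longleftrightarrow>
     (\<forall>x y. (\<forall>t. C *v (((*v) A ^^ t) x) = C *v (((*v) A ^^ t) y)) \<longrightarrow> x = y)"

text \<open>
  A schedule is the list of the intervals in one period; the index is reduced modulo its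
  length to extend it periodically.
\<close>

primrec sampling_time :: "nat list \<Rightarrow> nat \<Rightarrow> nat" where
  "sampling_time \<tau> 0 = 0"
| "sampling_time \<tau> (Suc k) = sampling_time \<tau> k + \<tau> ! (k mod length \<tau>)"

definition observed :: "nat list \<Rightarrow> nat \<Rightarrow> nat set" where
  "observed \<tau> t = {r. r \<le> t \<and> r \<in> range (sampling_time \<tau>)}"

text \<open>
  The information available at time \<open>t\<close> is the family of the states at the observed times,
  that is, an element of \<open>\<Pi>\<^sub>M r\<in>observed \<tau> t. borel\<close>. Measurability of the policy is what makes
  the expected cost meaningful.
\<close>

definition control_policy ::
  "nat list \<Rightarrow> (nat \<Rightarrow> (nat \<Rightarrow> real^'n) \<Rightarrow> real^'m) \<Rightarrow> bool" where
  "control_policy \<tau> \<mu> \<longleftrightarrow> (\<forall>t. \<mu> t \<in> (\<Pi>\<^sub>M r\<in>observed \<tau> t. borel) \<rightarrow>\<^sub>M borel)"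

lemma restrict_fundef_cong [fundef_cong]:
  "I = J \<Longrightarrow> (\<And>r. r \<in> J \<Longrightarrow> f r = g r) \<Longrightarrow> restrict f I = restrict g J"
  by (simp cong: restrict_cong)

text \<open>State and input of the closed loop for one realization \<open>w\<close> of the noise.\<close>

function closed_loop_state ::
  "real^'n^'n \<Rightarrow> real^'m^'n \<Rightarrow> real^'n \<Rightarrow> nat list \<Rightarrow>
   (nat \<Rightarrow> (nat \<Rightarrow> real^'n) \<Rightarrow> real^'m) \<Rightarrow> (nat \<Rightarrow> real^'n) \<Rightarrow> nat \<Rightarrow> real^'n" where
  "closed_loop_state A B x0 \<tau> \<mu> w 0 = x0"
| "closed_loop_state A B x0 \<tau> \<mu> w (Suc t) =
     A *v closed_loop_state A B x0 \<tau> \<mu> w t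
     + B *v \<mu> t (\<lambda>r\<in>observed \<tau> t. closed_loop_state A B x0 \<tau> \<mu> w r) + w t"
  by pat_completeness auto
termination
  by (relation "Wellfounded.measure (\<lambda>(A, B, x0, \<tau>, \<mu>, w, t). t)") (auto simp: observed_def)

definition closed_loop_input ::
  "real^'n^'n \<Rightarrow> real^'m^'n \<Rightarrow> real^'n \<Rightarrow> nat list \<Rightarrow>
   (nat \<Rightarrow> (nat \<Rightarrow> real^'n) \<Rightarrow> real^'m) \<Rightarrow> (nat \<Rightarrow> real^'n) \<Rightarrow> nat \<Rightarrow> real^'m" where
  "closed_loop_input A B x0 \<tau> \<mu> w t =
     \<mu> t (\<lambda>r\<in>observed \<tau> t. closed_loop_state A B x0 \<tau> \<mu> w r)"

definition closed_loop_output ::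
  "real^'n^'n \<Rightarrow> real^'m^'n \<Rightarrow> real^'n^'k \<Rightarrow> real^'m^'k \<Rightarrow> real^'n \<Rightarrow> nat list \<Rightarrow>
   (nat \<Rightarrow> (nat \<Rightarrow> real^'n) \<Rightarrow> real^'m) \<Rightarrow> (nat \<Rightarrow> real^'n) \<Rightarrow> nat \<Rightarrow> real^'k" where
  "closed_loop_output A B C\<^sub>2 D\<^sub>2\<^sub>1 x0 \<tau> \<mu> w t =
     C\<^sub>2 *v closed_loop_state A B x0 \<tau> \<mu> w t + D\<^sub>2\<^sub>1 *v closed_loop_input A B x0 \<tau> \<mu> w t"

text \<open>
  The expectation is the nonnegative integral, so that a policy whose cost is not integrable
  has average cost \<open>\<infinity>\<close> (the Bochner integral would assign it the value 0).
\<close>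

definition average_cost ::
  "'a measure \<Rightarrow> real^'n^'n \<Rightarrow> real^'m^'n \<Rightarrow> real^'n^'k \<Rightarrow> real^'m^'k \<Rightarrow> real^'n \<Rightarrow>
   (nat \<Rightarrow> 'a \<Rightarrow> real^'n) \<Rightarrow> nat list \<Rightarrow> (nat \<Rightarrow> (nat \<Rightarrow> real^'n) \<Rightarrow> real^'m) \<Rightarrow> nat \<Rightarrow> ennreal" where
  "average_cost M A B C\<^sub>2 D\<^sub>2\<^sub>1 x0 w \<tau> \<mu> T =
     (\<integral>\<^sup>+\<omega>. ennreal (\<Sum>t<T. (norm (closed_loop_output A B C\<^sub>2 D\<^sub>2\<^sub>1 x0 \<tau> \<mu> (\<lambda>s. w s \<omega>) t))\<^sup>2) \<partial>M)
       / of_nat T"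

text \<open>The competing policies are those whose average cost has a limit in \<open>[0, \<infinity>]\<close>.\<close>

definition J\<^sub>2 ::
  "'a measure \<Rightarrow> real^'n^'n \<Rightarrow> real^'m^'n \<Rightarrow> real^'n^'k \<Rightarrow> real^'m^'k \<Rightarrow> real^'n \<Rightarrow>
   (nat \<Rightarrow> 'a \<Rightarrow> real^'n) \<Rightarrow> nat list \<Rightarrow> ennreal" where
  "J\<^sub>2 M A B C\<^sub>2 D\<^sub>2\<^sub>1 x0 w \<tau> =
     Inf {c. \<exists>\<mu>. control_policy \<tau> \<mu> \<and> average_cost M A B C\<^sub>2 D\<^sub>2\<^sub>1 x0 w \<tau> \<mu> \<longlonglongrightarrow> c}"

end

theory Submission
  imports Defs
begin

text \<open>
  Value iteration \<open>P\<^sub>0 = 0\<close>, \<open>P\<^sub>k\<^sub>+\<^sub>1 = riccati P\<^sub>k\<close> increases, is bounded because every state can be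
  steered to the origin, and so converges to a solution \<open>P\<close> of the Riccati equation. Completing
  the square with \<open>P\<^sub>T\<^sub>-\<^sub>1\<^sub>-\<^sub>t\<close> at time \<open>t\<close> bounds the expected cost of any policy over the horizon \<open>T\<close>
  from below, since the noise that entered after the last sampling time is independent of the input;
  with \<open>P\<close> instead, certainty-equivalent feedback attains the same average in the limit. The
  resulting penalty of an interval of length \<open>n\<close> is \<open>\<beta>(n) = g(0) + \<dots> + g(n - 1)\<close> with \<open>g\<close>
  nondecreasing, hence convex in \<open>n\<close>, and balancing two intervals decreases the sum of penalties.
\<close>

subsection \<open>The Riccati equation\<close>

text \<open>Telescoping with the limit P leaves the terminal expectation of x_T^T P x_T. An upper
  bound may drop it, but a lower bound would have to control its growth under an arbitrary policy.
  Value iteration starts at 0, so its terminal term is zero; the price is that the weights depend on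
  the remaining horizon. Ages are smaller than the period, so only finitely many penalties have to
  converge, and the resulting error has Cesaro mean tending to 0. A competing policy may have inputs
  that are not square-integrable, so expectations cannot be split at once. Injectivity of
  \<open>D\<close> settles this: a finite cost through time n makes the input at n
  square-integrable, and otherwise the average is eventually infinite. The function g is monotone
  because g(a) is the expected weighted square of a prediction error of age a: one more step adds
  tr((A^T)^a Z A^a W), where Z is the \<open>estimation_weight\<close> of the limit, and this is
  nonnegative.\<close>

lemma inner_transpose_matrix: "(transpose A *v x) \<bullet> y = x \<bullet> ((A::real^'n^'m) *v y)"
  by (metis dot_lmul_matrix transpose_matrix_vector)

lemma inner_symmetric_matrix:
  fixes S :: "real^'n^'n"
  assumes "transpose S = S"
  shows "x \<bullet> (S *v y) = y \<bullet> (S *v x)"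
  by (metis assms inner_transpose_matrix inner_commute)

lemma quadratic_form_add:
  fixes S :: "real^'n^'n"
  assumes "transpose S = S"
  shows "(x + y) \<bullet> (S *v (x + y)) = x \<bullet> (S *v x) + 2 * (x \<bullet> (S *v y)) + y \<bullet> (S *v y)"
  using inner_symmetric_matrix[OF assms, of y x]
  by (simp add: matrix_vector_right_distrib inner_add_left inner_add_right)

lemma inner_transpose_mult:
  fixes X :: "real^'n^'m" and Y :: "real^'p^'m"
  shows "x \<bullet> ((transpose X ** Y) *v y) = (X *v x) \<bullet> (Y *v y)"
  using inner_transpose_matrix[of X "Y *v y" x]
  by (simp add: inner_commute flip: matrix_vector_mul_assoc)

lemma quadratic_form_congruence:
  fixes A :: "real^'n^'m" and S :: "real^'m^'m"
  shows "x \<bullet> ((transpose A ** S ** A) *v y) = (A *v x) \<bullet> (S *v (A *v y))"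
  using inner_transpose_mult[of x A "S ** A" y]
  by (simp add: matrix_mul_assoc flip: matrix_vector_mul_assoc)

lemma transpose_add: "transpose (A + B) = transpose A + transpose (B::real^'n^'m)"
  by (simp add: transpose_def vec_eq_iff)

lemma transpose_diff: "transpose (A - B) = transpose A - transpose (B::real^'n^'m)"
  by (simp add: transpose_def vec_eq_iff)

lemma transpose_congruence:
  fixes A :: "real^'n^'m" and S :: "real^'m^'m"
  assumes "transpose S = S"
  shows "transpose (transpose A ** S ** A) = transpose A ** S ** A"
  by (simp add: matrix_transpose_mul assms flip: matrix_mul_assoc)

lemma positive_semidefinite_congruence:
  fixes A :: "real^'n^'m" and S :: "real^'m^'m"
  assumes "positive_semidefinite S"
  shows "positive_semidefinite (transpose A ** S ** A)"
  using assms unfolding positive_semidefinite_def quadratic_form_congruence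
  by (simp add: transpose_congruence)

section \<open>Continuity of matrix operations and convergence of symmetric matrices\<close>

lemma tendsto_matrix_matrix_mult [tendsto_intros]:
  fixes X :: "'b \<Rightarrow> real^'n^'m" and Y :: "'b \<Rightarrow> real^'p^'n"
  assumes "(X \<longlongrightarrow> a) F" "(Y \<longlongrightarrow> b) F"
  shows "((\<lambda>k. X k ** Y k) \<longlongrightarrow> a ** b) F"
  unfolding matrix_matrix_mult_def by (intro tendsto_intros assms)

lemma tendsto_matrix_vector_mult [tendsto_intros]:
  fixes X :: "'b \<Rightarrow> real^'n^'m"
  assumes "(X \<longlongrightarrow> a) F" "(Y \<longlongrightarrow> b) F"
  shows "((\<lambda>k. X k *v Y k) \<longlongrightarrow> a *v b) F"
  unfolding matrix_vector_mult_def by (intro tendsto_intros assms)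

lemma tendsto_transpose [tendsto_intros]:
  fixes X :: "'b \<Rightarrow> real^'n^'m"
  assumes "(X \<longlongrightarrow> a) F"
  shows "((\<lambda>k. transpose (X k)) \<longlongrightarrow> transpose a) F"
  unfolding transpose_def by (intro tendsto_intros assms)

lemma tendsto_det:
  fixes X :: "'b \<Rightarrow> real^'n^'n"
  assumes "(X \<longlongrightarrow> a) F"
  shows "((\<lambda>k. det (X k)) \<longlongrightarrow> det a) F"
  unfolding det_def by (intro tendsto_intros assms)

text \<open>Cramer's rule writes the solution as quotients of determinants, which are continuous in
  the data. Gains are later passed to the limit through the linear systems that they solve, not
  through \<open>matrix_inv\<close>.\<close>

lemma tendsto_linear_solution:
  fixes X :: "'b \<Rightarrow> real^'n^'n"
  assumes "(X \<longlongrightarrow> a) F" "(Y \<longlongrightarrow> b) F"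
    and "\<And>k. det (X k) \<noteq> 0" "det a \<noteq> 0"
    and "\<And>k. X k *v Z k = Y k" "a *v c = b"
  shows "(Z \<longlongrightarrow> c) F"
proof -
  have "Z = (\<lambda>k. \<chi> i. det (\<chi> r s. if s = i then Y k $ r else X k $ r $ s) / det (X k))"
    using assms(3,5) by (auto simp: cramer)
  moreover have "c = (\<chi> i. det (\<chi> r s. if s = i then b $ r else a $ r $ s) / det a)"
    using assms(4,6) by (auto simp: cramer)
  moreover have "((\<lambda>k. if s = i then Y k $ r else X k $ r $ s) \<longlongrightarrow>
      (if s = i then b $ r else a $ r $ s)) F" for i r s
    using tendsto_vec_nth[OF assms(2)] tendsto_vec_nth[OF tendsto_vec_nth[OF assms(1)]] by simp
  ultimately show ?thesis
    by (auto intro!: tendsto_vec_lambda tendsto_divide tendsto_det assms)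
qed

lemma tendsto_matrixI:
  fixes X :: "'b \<Rightarrow> real^'n^'m"
  assumes "\<And>x. ((\<lambda>k. X k *v x) \<longlongrightarrow> a *v x) F"
  shows "(X \<longlongrightarrow> a) F"
proof (intro vec_tendstoI)
  fix i j
  show "((\<lambda>k. X k $ i $ j) \<longlongrightarrow> a $ i $ j) F"
    using tendsto_vec_nth[OF assms[of "axis j 1"], of i]
    by (simp add: matrix_vector_mul_component inner_axis)
qed

text \<open>By polarization each entry is a combination of three values of the quadratic form, so
  monotone convergence of real sequences will suffice for value iteration.\<close>

lemma convergent_symmetric_matrix:
  fixes X :: "nat \<Rightarrow> real^'n^'n"
  assumes sym: "\<And>k. transpose (X k) = X k"
    and conv: "\<And>x. convergent (\<lambda>k. x \<bullet> (X k *v x))"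
  shows "convergent X"
proof -
  have "convergent (\<lambda>k. X k $ i $ j)" for i j
  proof -
    have "X k $ i $ j = axis i 1 \<bullet> (X k *v axis j 1)" for k
      by (simp add: inner_axis' matrix_vector_mul_component inner_axis)
    then have "X k $ i $ j = ((axis i 1 + axis j 1) \<bullet> (X k *v (axis i 1 + axis j 1))
        - axis i 1 \<bullet> (X k *v axis i 1) - axis j 1 \<bullet> (X k *v axis j 1)) / 2" for k
      using quadratic_form_add[OF sym, of "axis i 1" "axis j 1" k] by simp
    moreover have "convergent (\<lambda>k. ((axis i 1 + axis j 1) \<bullet> (X k *v (axis i 1 + axis j 1))
        - axis i 1 \<bullet> (X k *v axis i 1) - axis j 1 \<bullet> (X k *v axis j 1)) * inverse 2)"
      by (intro convergent_diff convergent_mult conv convergent_const)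
    ultimately show ?thesis by (simp only: divide_inverse)
  qed
  then obtain L where "\<And>i j. (\<lambda>k. X k $ i $ j) \<longlonglongrightarrow> L i j"
    unfolding convergent_def by metis
  then have "X \<longlonglongrightarrow> (\<chi> i j. L i j)"
    by (intro vec_tendstoI) simp
  then show ?thesis by (rule convergentI)
qed

section \<open>One-step minimization and value iteration\<close>

locale linear_quadratic =
  fixes A :: "real^'n^'n" and B :: "real^'m^'n" and C :: "real^'n^'k" and D :: "real^'m^'k"
  assumes output_orthogonal: "transpose C ** D = 0"
    and input_weight: "positive_definite (transpose D ** D)"
begin

definition input_hessian :: "real^'n^'n \<Rightarrow> real^'m^'m" where
  "input_hessian S = transpose D ** D + transpose B ** S ** B"

definition gain :: "real^'n^'n \<Rightarrow> real^'n^'m" where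
  "gain S = matrix_inv (input_hessian S) ** (transpose B ** S ** A)"

text \<open>For semidefinite \<open>S\<close> this is A^T S B (R + B^T S B)^{-1} B^T S A, hence Z
  for S = P. Written as a congruence it is visibly semidefinite, and it shows how an estimation
  error is weighed after passing through the gain.\<close>

definition estimation_weight :: "real^'n^'n \<Rightarrow> real^'n^'n" where
  "estimation_weight S = transpose (gain S) ** input_hessian S ** gain S"

definition riccati :: "real^'n^'n \<Rightarrow> real^'n^'n" where
  "riccati S = transpose C ** C + transpose A ** S ** A - estimation_weight S"

primrec value_matrix :: "nat \<Rightarrow> real^'n^'n" where
  "value_matrix 0 = 0"
| "value_matrix (Suc k) = riccati (value_matrix k)"

lemma norm_output: "(norm (C *v x + D *v u))\<^sup>2 = (norm (C *v x))\<^sup>2 + (norm (D *v u))\<^sup>2"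
proof -
  have "(C *v x) \<bullet> (D *v u) = 0"
    using inner_transpose_mult[of x C D u] by (simp add: output_orthogonal)
  then show ?thesis
    by (simp add: power2_norm_eq_inner inner_add_left inner_add_right
        inner_commute)
qed

lemma input_hessian_quadratic:
  "x \<bullet> (input_hessian S *v y) = (D *v x) \<bullet> (D *v y) + (B *v x) \<bullet> (S *v (B *v y))"
  unfolding input_hessian_def
  by (simp add: matrix_vector_mult_add_rdistrib inner_add_right quadratic_form_congruence
      inner_transpose_mult)

lemma input_injective: "u \<noteq> 0 \<Longrightarrow> 0 < (norm (D *v u))\<^sup>2"
  using input_weight unfolding positive_definite_def
  by (simp add: inner_transpose_mult power2_norm_eq_inner)

context
  fixes S :: "real^'n^'n"
  assumes psd: "positive_semidefinite S"
begin

lemma transpose_input_hessian: "transpose (input_hessian S) = input_hessian S"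
  using psd unfolding positive_semidefinite_def input_hessian_def
  by (simp add: transpose_add transpose_congruence, simp add: matrix_transpose_mul)

lemma input_hessian_nonneg: "0 \<le> u \<bullet> (input_hessian S *v u)"
  using psd unfolding positive_semidefinite_def input_hessian_quadratic by simp

lemma invertible_input_hessian: "invertible (input_hessian S)"
proof -
  have "u = 0" if "input_hessian S *v u = 0" for u
  proof (rule ccontr)
    assume "u \<noteq> 0"
    then have "0 < u \<bullet> (input_hessian S *v u)"
      using psd input_injective[of u] unfolding positive_semidefinite_def input_hessian_quadratic
      by (simp add: power2_norm_eq_inner add_pos_nonneg)
    with that show False by simp
  qed
  then show ?thesis
    using invertible_left_inverse matrix_left_invertible_ker by blast
qed

lemma input_hessian_gain: "input_hessian S *v (gain S *v x) = transpose B *v (S *v (A *v x))"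
proof -
  have "input_hessian S ** gain S = transpose B ** S ** A"
    \<comment> \<open>\<open>matrix_inv\<close> is defined by choice, so its inverse property is
      drawn from invertibility.\<close>
    unfolding gain_def matrix_inv_def using someI_ex[OF invertible_input_hessian[unfolded invertible_def]]
    by (simp add: matrix_mul_assoc)
  then show ?thesis by (metis matrix_vector_mul_assoc)
qed

lemma positive_semidefinite_estimation_weight: "positive_semidefinite (estimation_weight S)"
  unfolding estimation_weight_def using transpose_input_hessian input_hessian_nonneg
  by (intro positive_semidefinite_congruence) (simp add: positive_semidefinite_def)

text \<open>Completing the square in \<open>u\<close>: \<open>input_hessian_gain\<close> turns the
  cross term of the left side into that of the square, and the constant part of the square is what
  \<open>riccati\<close> subtracts.\<close>

lemma bellman_equation:
  "(norm (C *v x + D *v u))\<^sup>2 + (A *v x + B *v u) \<bullet> (S *v (A *v x + B *v u)) =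
   x \<bullet> (riccati S *v x) + (u + gain S *v x) \<bullet> (input_hessian S *v (u + gain S *v x))"
proof -
  have cross: "(A *v x) \<bullet> (S *v (B *v u)) = u \<bullet> (input_hessian S *v (gain S *v x))"
    using psd inner_transpose_matrix[of B "S *v (A *v x)" u]
      inner_symmetric_matrix[of S "A *v x" "B *v u"]
    by (simp add: input_hessian_gain positive_semidefinite_def inner_commute)
  have "x \<bullet> (riccati S *v x) = (norm (C *v x))\<^sup>2 + (A *v x) \<bullet> (S *v (A *v x))
      - (gain S *v x) \<bullet> (input_hessian S *v (gain S *v x))"
    unfolding riccati_def estimation_weight_def
    by (simp add: matrix_vector_mult_diff_rdistrib matrix_vector_mult_add_rdistrib
        inner_diff_right inner_add_right quadratic_form_congruence inner_transpose_mult
        power2_norm_eq_inner)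
  moreover have "u \<bullet> (input_hessian S *v u) = (norm (D *v u))\<^sup>2 + (B *v u) \<bullet> (S *v (B *v u))"
    by (simp add: input_hessian_quadratic power2_norm_eq_inner)
  moreover have "transpose S = S" using psd by (simp add: positive_semidefinite_def)
  ultimately show ?thesis
    using cross by (simp add: norm_output quadratic_form_add transpose_input_hessian)
qed

text \<open>The square in \<open>bellman_equation\<close> is nonnegative and vanishes at
  \<open>u = - (gain S *v x)\<close>, so the Riccati form is a minimum over inputs. Comparisons of
  Riccati iterates rest on this description.\<close>

lemma riccati_le:
  "x \<bullet> (riccati S *v x) \<le>
   (norm (C *v x + D *v u))\<^sup>2 + (A *v x + B *v u) \<bullet> (S *v (A *v x + B *v u))"
  unfolding bellman_equation using input_hessian_nonneg by simp

lemma riccati_attained: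
  "x \<bullet> (riccati S *v x) = (norm (C *v x + D *v (- (gain S *v x))))\<^sup>2
     + (A *v x + B *v (- (gain S *v x))) \<bullet> (S *v (A *v x + B *v (- (gain S *v x))))"
  unfolding bellman_equation by simp

lemma positive_semidefinite_riccati: "positive_semidefinite (riccati S)"
  unfolding positive_semidefinite_def
proof (intro conjI allI)
  have "transpose (estimation_weight S) = estimation_weight S"
    using positive_semidefinite_estimation_weight by (simp add: positive_semidefinite_def)
  then show "transpose (riccati S) = riccati S"
    using psd unfolding riccati_def positive_semidefinite_def
    by (simp add: transpose_diff transpose_add transpose_congruence, simp add: matrix_transpose_mul)
  show "0 \<le> x \<bullet> (riccati S *v x)" for x
    unfolding riccati_attained using psd by (simp add: positive_semidefinite_def)
qed

end

lemma positive_semidefinite_value_matrix: "positive_semidefinite (value_matrix k)"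
  by (induction k)
    (simp_all add: positive_semidefinite_riccati, simp add: positive_semidefinite_def transpose_def vec_eq_iff)

lemma value_matrix_mono: "x \<bullet> (value_matrix k *v x) \<le> x \<bullet> (value_matrix (Suc k) *v x)"
proof (induction k arbitrary: x)
  case 0
  show ?case using positive_semidefinite_value_matrix[of 1] by (simp add: positive_semidefinite_def)
next
  case (Suc k)
  note [simp] = positive_semidefinite_value_matrix
  \<comment> \<open>The minimizer for the larger matrix is merely admissible for the smaller one;
    the successor states are compared by the induction hypothesis.\<close>
  let ?u = "- (gain (value_matrix (Suc k)) *v x)"
  have "x \<bullet> (riccati (value_matrix k) *v x) \<le> (norm (C *v x + D *v ?u))\<^sup>2
      + (A *v x + B *v ?u) \<bullet> (value_matrix k *v (A *v x + B *v ?u))"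
    by (rule riccati_le) simp
  also have "\<dots> \<le> (norm (C *v x + D *v ?u))\<^sup>2
      + (A *v x + B *v ?u) \<bullet> (value_matrix (Suc k) *v (A *v x + B *v ?u))"
    using Suc.IH by (rule add_left_mono)
  also have "\<dots> = x \<bullet> (riccati (value_matrix (Suc k)) *v x)"
    by (rule riccati_attained[symmetric]) (simp del: value_matrix.simps)
  finally show ?case by simp
qed

text \<open>\<open>value_matrix\<close> recurses on the first step of the horizon,
  \<open>noiseless_state\<close> on the last.\<close>

lemma noiseless_state_shift:
  "noiseless_state A B x u (Suc t) = noiseless_state A B (A *v x + B *v u 0) (\<lambda>s. u (Suc s)) t"
  by (induction t) simp_all

text \<open>Any input sequence may replace the successive minimizers. Boundedness will follow from
  one well-chosen sequence.\<close>

lemma value_matrix_le_cost: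
  "x \<bullet> (value_matrix k *v x) \<le> (\<Sum>t<k. (norm (C *v noiseless_state A B x u t + D *v u t))\<^sup>2)"
proof (induction k arbitrary: x u)
  case 0
  show ?case by simp
next
  case (Suc k)
  have "x \<bullet> (value_matrix (Suc k) *v x) \<le> (norm (C *v x + D *v u 0))\<^sup>2
      + (A *v x + B *v u 0) \<bullet> (value_matrix k *v (A *v x + B *v u 0))"
    using riccati_le[OF positive_semidefinite_value_matrix] by simp
  also have "\<dots> \<le> (norm (C *v x + D *v u 0))\<^sup>2 + (\<Sum>t<k. (norm (C *v
      noiseless_state A B (A *v x + B *v u 0) (\<lambda>s. u (Suc s)) t + D *v u (Suc t)))\<^sup>2)"
    using Suc.IH by (rule add_left_mono)
  also have "\<dots> = (\<Sum>t<Suc k. (norm (C *v noiseless_state A B x u t + D *v u t))\<^sup>2)"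
    unfolding sum.lessThan_Suc_shift noiseless_state_shift by simp
  finally show ?case .
qed

text \<open>An input that steers \<open>x\<close> to the origin and is zero afterwards has a cost
  that stops growing with the horizon.\<close>

lemma value_matrix_bounded:
  assumes "controllable A B"
  shows "\<exists>b. \<forall>k. x \<bullet> (value_matrix k *v x) \<le> b"
proof -
  obtain N u where N: "noiseless_state A B x u N = 0"
    using assms unfolding controllable_def by metis
  define v where "v t = (if t < N then u t else 0)" for t
  have "noiseless_state A B x v t = noiseless_state A B x u t" if "t \<le> N" for t
    using that by (induction t) (auto simp: v_def)
  then have "noiseless_state A B x v (N + t) = 0" for t
    using N by (induction t) (auto simp: v_def)
  then have zero: "noiseless_state A B x v t = 0" "v t = 0" if "N \<le> t" for t
    using that by (metis le_add_diff_inverse, simp add: v_def)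
  have "(\<Sum>t<k. (norm (C *v noiseless_state A B x v t + D *v v t))\<^sup>2)
      \<le> (\<Sum>t<N. (norm (C *v noiseless_state A B x v t + D *v v t))\<^sup>2)" for k
  proof -
    \<comment> \<open>The horizon \<open>max k N\<close> treats \<open>k < N\<close> and
      \<open>k \<ge> N\<close> together: extending the sum adds nonnegative terms, and those from
      \<open>N\<close> on vanish.\<close>
    have "(\<Sum>t<k. (norm (C *v noiseless_state A B x v t + D *v v t))\<^sup>2)
       \<le> (\<Sum>t<max k N. (norm (C *v noiseless_state A B x v t + D *v v t))\<^sup>2)"
      by (intro sum_mono2) auto
    also have "\<dots> = (\<Sum>t<N. (norm (C *v noiseless_state A B x v t + D *v v t))\<^sup>2)"
      by (intro sum.mono_neutral_right) (auto simp: zero)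
    finally show ?thesis .
  qed
  then show ?thesis using value_matrix_le_cost order_trans by blast
qed

section \<open>The limit of value iteration\<close>

definition value_limit :: "real^'n^'n" where
  "value_limit = lim value_matrix"

context
  assumes controllable: "controllable A B"
begin

lemma value_matrix_tendsto: "value_matrix \<longlonglongrightarrow> value_limit"
proof -
  have "convergent (\<lambda>k. x \<bullet> (value_matrix k *v x))" for x
  proof -
    obtain b where "\<And>k. x \<bullet> (value_matrix k *v x) \<le> b"
      using value_matrix_bounded[OF controllable] by blast
    moreover have "incseq (\<lambda>k. x \<bullet> (value_matrix k *v x))"
      by (rule incseq_SucI) (rule value_matrix_mono)
    ultimately show ?thesis
      by (metis incseq_convergent convergentI)
  qed
  then have "convergent value_matrix"
    using positive_semidefinite_value_matrix
    by (intro convergent_symmetric_matrix) (auto simp: positive_semidefinite_def)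
  then show ?thesis by (simp add: value_limit_def convergent_LIMSEQ_iff)
qed

lemma positive_semidefinite_value_limit: "positive_semidefinite value_limit"
  unfolding positive_semidefinite_def
proof (intro conjI allI)
  note psd = positive_semidefinite_value_matrix[unfolded positive_semidefinite_def]
  show "transpose value_limit = value_limit"
    using tendsto_transpose[OF value_matrix_tendsto] value_matrix_tendsto psd
    by (intro LIMSEQ_unique) auto
  show "0 \<le> x \<bullet> (value_limit *v x)" for x
    by (rule LIMSEQ_le_const[where X = "\<lambda>k. x \<bullet> (value_matrix k *v x)"])
      (use psd in \<open>auto intro!: tendsto_intros value_matrix_tendsto\<close>)
qed

lemma input_hessian_tendsto: "(\<lambda>k. input_hessian (value_matrix k)) \<longlonglongrightarrow> input_hessian value_limit"
  unfolding input_hessian_def by (intro tendsto_intros value_matrix_tendsto)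

lemma gain_tendsto: "(\<lambda>k. gain (value_matrix k)) \<longlonglongrightarrow> gain value_limit"
proof (rule tendsto_matrixI)
  fix x
  let ?Y = "\<lambda>S. transpose B *v (S *v (A *v x))"
  have "(\<lambda>k. ?Y (value_matrix k)) \<longlonglongrightarrow> ?Y value_limit"
    by (intro tendsto_intros value_matrix_tendsto)
  \<comment> \<open>The iterates and the limit are all semidefinite, so each of these linear systems
    for the gain applied to \<open>x\<close> is regular, including the one at the limit.\<close>
  moreover have "det (input_hessian S) \<noteq> 0" "input_hessian S *v (gain S *v x) = ?Y S"
    if "positive_semidefinite S" for S
    using invertible_input_hessian[OF that] input_hessian_gain[OF that]
    by (simp_all add: invertible_det_nz)
  ultimately show "(\<lambda>k. gain (value_matrix k) *v x) \<longlonglongrightarrow> gain value_limit *v x"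
    using positive_semidefinite_value_matrix positive_semidefinite_value_limit
    by (blast intro: tendsto_linear_solution[OF input_hessian_tendsto])
qed

lemma estimation_weight_tendsto:
  "(\<lambda>k. estimation_weight (value_matrix k)) \<longlonglongrightarrow> estimation_weight value_limit"
  unfolding estimation_weight_def by (intro tendsto_intros gain_tendsto input_hessian_tendsto)

lemma riccati_value_limit: "riccati value_limit = value_limit"
proof (rule LIMSEQ_unique)
  show "(\<lambda>k. value_matrix (Suc k)) \<longlonglongrightarrow> value_limit"
    by (rule LIMSEQ_Suc[OF value_matrix_tendsto])
  show "(\<lambda>k. value_matrix (Suc k)) \<longlonglongrightarrow> riccati value_limit"
    unfolding value_matrix.simps riccati_def
    by (intro tendsto_intros value_matrix_tendsto estimation_weight_tendsto)
qed

end

end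

subsection \<open>Schedules and sample ages\<close>

lemma sum_lessThan_add:
  "(\<Sum>k<n + p. g k) = (\<Sum>k<n. g k) + (\<Sum>k<p. g (n + k :: nat) :: 'b::comm_monoid_add)"
  by (induction p) (simp_all add: ac_simps)

text \<open>The terms at \<open>b - p\<close>, ..., \<open>b - 1\<close> are exchanged for those at
  \<open>a\<close>, ..., \<open>a + p - 1\<close>. This is discrete convexity of the partial sums of
  \<open>g\<close>.\<close>

lemma sum_exchange_le:
  fixes g :: "nat \<Rightarrow> real"
  assumes "mono g" "a < b" "p \<le> (b - a) div 2"
  shows "(\<Sum>k<b - p. g k) + (\<Sum>k<a + p. g k) \<le> (\<Sum>k<b. g k) + (\<Sum>k<a. g k)"
proof -
  \<comment> \<open>The bound on \<open>p\<close> says exactly that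
    \<open>a + p \<le> b - p\<close>: every index gained lies below every index lost.\<close>
  have b: "b = (b - p) + p" and le: "a + p \<le> b - p" using assms(2,3) by auto
  have "(\<Sum>k<p. g (a + k)) \<le> (\<Sum>k<p. g (b - p + k))"
    using le by (intro sum_mono monoD[OF assms(1)]) auto
  then show ?thesis using b sum_lessThan_add[of g a p] sum_lessThan_add[of g "b - p" p] by simp
qed

lemma cesaro_tendsto:
  fixes X :: "nat \<Rightarrow> real"
  assumes "X \<longlonglongrightarrow> c"
  shows "(\<lambda>n. (\<Sum>k<n. X k) / real n) \<longlonglongrightarrow> c"
proof (rule LIMSEQ_I)
  fix e :: real assume e: "0 < e"
  obtain N where N: "\<And>n. n \<ge> N \<Longrightarrow> norm (X n - c) < e / 2"
    using LIMSEQ_D[OF assms, of "e / 2"] e by auto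
  \<comment> \<open>\<open>K\<close> is the fixed error of the first \<open>N\<close> terms.
    \<open>M\<close> is chosen so that \<open>K\<close> stays below \<open>n * e / 2\<close>; the
    later terms contribute at most \<open>e / 2\<close> each.\<close>
  define K where "K = (\<Sum>k<N. \<bar>X k - c\<bar>)"
  obtain M where M: "2 * K / e < real M" using reals_Archimedean2 by blast
  have "norm ((\<Sum>k<n. X k) / real n - c) < e" if n: "n \<ge> max (Suc N) (Suc M)" for n
  proof -
    have "\<bar>\<Sum>k<n. X k - c\<bar> \<le> (\<Sum>k<n. \<bar>X k - c\<bar>)" by (rule sum_abs)
    also have "\<dots> = K + (\<Sum>k\<in>{N..<n}. \<bar>X k - c\<bar>)"
      unfolding K_def lessThan_atLeast0 using n by (subst sum.atLeastLessThan_concat) auto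
    also have "\<dots> \<le> K + real (card {N..<n}) * (e / 2)"
      using N by (intro add_left_mono sum_bounded_above) (auto intro: less_imp_le)
    also have "\<dots> \<le> K + real n * (e / 2)" using e by auto
    also have "\<dots> < real n * e"
    proof -
      have "2 * K < e * real n"
        using M n e by (smt (verit) max.bounded_iff mult_le_cancel_left_pos of_nat_mono
            pos_divide_less_eq mult.commute of_nat_Suc)
      then show ?thesis by (simp add: mult.commute)
    qed
    finally have "\<bar>\<Sum>k<n. X k - c\<bar> < real n * e" .
    moreover have "(\<Sum>k<n. X k) / real n - c = (\<Sum>k<n. X k - c) / real n"
      using n by (simp add: sum_subtractf field_simps)
    ultimately show ?thesis using n by (simp add: pos_divide_less_eq mult.commute)
  qed
  then show "\<exists>no. \<forall>n\<ge>no. norm ((\<Sum>k<n. X k) / real n - c) < e" by blast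
qed

definition last_sample :: "nat list \<Rightarrow> nat \<Rightarrow> nat" where
  "last_sample \<tau> t = Max (observed \<tau> t)"

definition age :: "nat list \<Rightarrow> nat \<Rightarrow> nat" where
  "age \<tau> t = t - last_sample \<tau> t"

lemma finite_observed [simp]: "finite (observed \<tau> t)"
  by (rule finite_subset[of _ "{..t}"]) (auto simp: observed_def)

lemma last_sample_in_observed: "last_sample \<tau> t \<in> observed \<tau> t"
proof -
  have "0 \<in> observed \<tau> t" by (auto simp: observed_def intro: range_eqI[of _ _ 0])
  then show ?thesis unfolding last_sample_def by (intro Max_in) auto
qed

lemma last_sample_le: "last_sample \<tau> t \<le> t"
  using last_sample_in_observed[of \<tau> t] by (simp add: observed_def)

lemma observed_le_last_sample: "r \<in> observed \<tau> t \<Longrightarrow> r \<le> last_sample \<tau> t"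
  unfolding last_sample_def by simp

text \<open>No sampling time lies after the last one up to \<open>t\<close>, so the information is
  frozen there. This is what separates the inputs from the noise entering since.\<close>

lemma observed_after_last_sample:
  assumes "last_sample \<tau> t \<le> m" "m \<le> t"
  shows "observed \<tau> m = observed \<tau> t" "last_sample \<tau> m = last_sample \<tau> t"
proof -
  show "observed \<tau> m = observed \<tau> t"
    using assms observed_le_last_sample[of _ \<tau> t] by (fastforce simp: observed_def)
  then show "last_sample \<tau> m = last_sample \<tau> t" by (simp add: last_sample_def)
qed

locale schedule =
  fixes \<tau> :: "nat list"
  assumes nonempty: "0 < length \<tau>" and positive: "\<And>k. k < length \<tau> \<Longrightarrow> 0 < \<tau> ! k"
begin

definition period :: nat where
  "period = (\<Sum>k<length \<tau>. \<tau> ! k)"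

lemma interval_positive: "0 < \<tau> ! (k mod length \<tau>)"
  using nonempty positive by simp

lemma interval_le_period: "\<tau> ! (k mod length \<tau>) \<le> period"
  unfolding period_def using nonempty by (intro member_le_sum) auto

lemma period_positive: "0 < period"
  using interval_positive interval_le_period by (rule less_le_trans)

lemma strict_mono_sampling_time: "strict_mono (sampling_time \<tau>)"
  by (rule strict_mono_Suc_iff[THEN iffD2]) (simp add: interval_positive)

lemma age_in_interval:
  assumes "a < \<tau> ! (k mod length \<tau>)"
  shows "age \<tau> (sampling_time \<tau> k + a) = a"
proof -
  have "r \<le> sampling_time \<tau> k" if "r \<in> observed \<tau> (sampling_time \<tau> k + a)" for r
  proof -
    obtain i where i: "r = sampling_time \<tau> i" "r \<le> sampling_time \<tau> k + a"
      using \<open>r \<in> _\<close> by (auto simp: observed_def)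
    then have "sampling_time \<tau> i < sampling_time \<tau> (Suc k)" using assms by simp
    then show ?thesis
      using strict_mono_less[OF strict_mono_sampling_time]
        strict_mono_less_eq[OF strict_mono_sampling_time] i(1) by (metis less_Suc_eq_le)
  qed
  moreover have "sampling_time \<tau> k \<in> observed \<tau> (sampling_time \<tau> k + a)"
    by (simp add: observed_def)
  ultimately have "last_sample \<tau> (sampling_time \<tau> k + a) = sampling_time \<tau> k"
    unfolding last_sample_def by (intro Max_eqI) auto
  then show ?thesis by (simp add: age_def)
qed

lemma in_interval: "\<exists>k a. t = sampling_time \<tau> k + a \<and> a < \<tau> ! (k mod length \<tau>)"
proof (induction t)
  case 0
  show ?case using interval_positive[of 0] by (intro exI[of _ 0]) simp
next
  case (Suc t)
  then obtain k a where ka: "t = sampling_time \<tau> k + a" "a < \<tau> ! (k mod length \<tau>)" by blast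
  show ?case
  proof (cases "Suc a < \<tau> ! (k mod length \<tau>)")
    case True
    then show ?thesis using ka(1) by (intro exI[of _ k] exI[of _ "Suc a"]) simp
  next
    case False
    then show ?thesis using ka interval_positive by (intro exI[of _ "Suc k"] exI[of _ 0]) auto
  qed
qed

lemma age_less_period: "age \<tau> t < period"
  using in_interval[of t] age_in_interval interval_le_period by (metis less_le_trans)

text \<open>Within an interval of length n the ages run through 0, ..., n - 1 once. Sums over time
  thereby become sums of interval penalties.\<close>

lemma sum_age_sampling_time:
  "(\<Sum>t<sampling_time \<tau> m. g (age \<tau> t)) = (\<Sum>k<m. \<Sum>a<\<tau> ! (k mod length \<tau>). (g a :: real))"
proof (induction m)
  case 0
  show ?case by simp
next
  case (Suc m)
  let ?s = "sampling_time \<tau> m" and ?n = "\<tau> ! (m mod length \<tau>)"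
  have "(\<Sum>a<?n. g (age \<tau> (?s + a))) = (\<Sum>a<?n. g a)"
    by (intro sum.cong) (auto simp: age_in_interval)
  then show ?case using Suc by (simp add: sum_lessThan_add)
qed

lemma sum_periodic:
  "(\<Sum>k<q * n. f (k mod n)) = of_nat q * (\<Sum>k<n. f k :: 'b::comm_semiring_1)"
proof (induction q)
  case 0
  show ?case by simp
next
  case (Suc q)
  have "(\<Sum>k<n. f ((q * n + k) mod n)) = (\<Sum>k<n. f k)" by (intro sum.cong) auto
  moreover have "Suc q * n = q * n + n" by simp
  ultimately show ?case
    using Suc by (simp only: sum_lessThan_add) (simp add: algebra_simps)
qed

lemma sampling_time_eq_sum: "sampling_time \<tau> m = (\<Sum>k<m. \<tau> ! (k mod length \<tau>))"
  by (induction m) simp_all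

lemma sampling_time_period: "sampling_time \<tau> (q * length \<tau>) = q * period"
  using sum_periodic[of "(!) \<tau>" "length \<tau>" q]
  by (simp add: sampling_time_eq_sum period_def)

text \<open>Partial sums are monotone because \<open>g\<close> is nonnegative, so an incomplete
  period changes the total by at most \<open>b\<close>, the contribution of a full one.\<close>

lemma age_average:
  fixes g :: "nat \<Rightarrow> real"
  assumes nonneg: "\<And>a. 0 \<le> g a"
  shows "(\<lambda>T. (\<Sum>t<T. g (age \<tau> t)) / real T) \<longlonglongrightarrow> (\<Sum>k<length \<tau>. \<Sum>a<\<tau> ! k. g a) / real period"
proof -
  define F where "F T = (\<Sum>t<T. g (age \<tau> t))" for T
  define b where "b = (\<Sum>k<length \<tau>. \<Sum>a<\<tau> ! k. g a)"
  have F_mono: "mono F" unfolding F_def using nonneg by (intro monoI sum_mono2) auto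
  have F_period: "F (q * period) = real q * b" for q
    using sum_periodic[of "\<lambda>k. \<Sum>a<\<tau> ! k. g a" "length \<tau>" q]
    by (simp add: F_def b_def sum_age_sampling_time flip: sampling_time_period)
  have b_nonneg: "0 \<le> b" unfolding b_def using nonneg by (intro sum_nonneg) auto
  have close: "\<bar>F T / real T - b / real period\<bar> \<le> b / real T" if "0 < T" for T
  proof -
    define q where "q = T div period"
    have q1: "q * period \<le> T" and q2: "T \<le> Suc q * period"
      using period_positive dividend_less_div_times[of period T] by (simp_all add: q_def add.commute)
    have "real q * b \<le> F T" "F T \<le> real (Suc q) * b"
      using monoD[OF F_mono q1] monoD[OF F_mono q2] F_period by metis+
    moreover have "real q * b \<le> real T * (b / real period)"
    proof -
      have "real q * b * real period \<le> real T * b"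
        using mult_right_mono[OF of_nat_mono[OF q1, where 'a=real] b_nonneg] by (simp add: ac_simps)
      then show ?thesis using period_positive by (simp add: pos_le_divide_eq)
    qed
    moreover have "real T * (b / real period) \<le> real (Suc q) * b"
    proof -
      have "real T * b \<le> real (Suc q) * b * real period"
        using mult_right_mono[OF of_nat_mono[OF q2, where 'a=real] b_nonneg] by (simp add: algebra_simps)
      then show ?thesis using period_positive by (simp add: pos_divide_le_eq)
    qed
    \<comment> \<open>Both numbers lie between \<open>q * b\<close> and
      \<open>(q + 1) * b\<close>.\<close>
    ultimately have "\<bar>F T - real T * (b / real period)\<bar> \<le> b" by (simp add: algebra_simps)
    then have "\<bar>F T - real T * (b / real period)\<bar> / real T \<le> b / real T"
      by (simp add: divide_right_mono)
    moreover have "F T / real T - b / real period = (F T - real T * (b / real period)) / real T"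
      using that by (simp add: diff_divide_distrib)
    ultimately show ?thesis by (simp add: abs_divide)
  qed
  have "(\<lambda>T. F T / real T - b / real period) \<longlonglongrightarrow> 0"
  proof (rule Lim_null_comparison)
    show "\<forall>\<^sub>F T in sequentially. norm (F T / real T - b / real period) \<le> b / real T"
      using eventually_gt_at_top[of 0] by eventually_elim (simp add: close)
    show "(\<lambda>T. b / real T) \<longlonglongrightarrow> 0" by (rule lim_const_over_n)
  qed
  then show ?thesis by (simp add: F_def b_def LIM_zero_iff)
qed

end

section \<open>Causality and measurability of the closed loop, and its split at the last sampling
  time\<close>

lemma closed_loop_state_cong:
  "(\<And>r. r < t \<Longrightarrow> v r = w r) \<Longrightarrow>
    closed_loop_state A B x0 \<tau> \<mu> v t = closed_loop_state A B x0 \<tau> \<mu> w t"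
\<comment> \<open>Strong induction, because the policy may use every earlier observed state.\<close>
proof (induction t rule: less_induct)
  case (less t)
  show ?case
  proof (cases t)
    case 0
    then show ?thesis by simp
  next
    case (Suc n)
    have "closed_loop_state A B x0 \<tau> \<mu> v r = closed_loop_state A B x0 \<tau> \<mu> w r" if "r \<le> n" for r
      using less that Suc by simp
    moreover from this have "(\<lambda>r\<in>observed \<tau> n. closed_loop_state A B x0 \<tau> \<mu> v r)
        = (\<lambda>r\<in>observed \<tau> n. closed_loop_state A B x0 \<tau> \<mu> w r)"
      by (intro restrict_ext) (auto simp: observed_def)
    ultimately show ?thesis using less.prems Suc by simp
  qed
qed

lemma measurable_matrix_vector_mult [measurable]:
  "(\<lambda>x. (A::real^'n^'m) *v x) \<in> borel_measurable borel"
  by (intro borel_measurable_continuous_onI linear_continuous_on linear_conv_bounded_linear[THEN iffD1]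
      matrix_vector_mul_linear)

text \<open>The space \<open>N\<close> is left open for two uses: with the probability space it
  yields random variables, with a product space of noise values it exhibits the state as a
  measurable function of the noise.\<close>

lemma measurable_closed_loop_state:
  assumes "control_policy \<tau> \<mu>"
  shows "(\<And>r. r < t \<Longrightarrow> w r \<in> borel_measurable N) \<Longrightarrow>
    (\<lambda>\<omega>. closed_loop_state A B x0 \<tau> \<mu> (\<lambda>r. w r \<omega>) t) \<in> borel_measurable N"
proof (induction t rule: less_induct)
  case (less t)
  show ?case
  proof (cases t)
    case 0
    then show ?thesis by simp
  next
    case (Suc n)
    have x [measurable]: "(\<lambda>\<omega>. closed_loop_state A B x0 \<tau> \<mu> (\<lambda>r. w r \<omega>) r) \<in> borel_measurable N"
      if "r \<le> n" for r
      using less that Suc by simp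
    have [measurable]: "w n \<in> borel_measurable N" using less.prems Suc by simp
    have [measurable]: "\<mu> n \<in> (\<Pi>\<^sub>M r\<in>observed \<tau> n. borel) \<rightarrow>\<^sub>M borel"
      using assms by (simp add: control_policy_def)
    have [measurable]: "(\<lambda>\<omega>. \<lambda>r\<in>observed \<tau> n. closed_loop_state A B x0 \<tau> \<mu> (\<lambda>r. w r \<omega>) r)
        \<in> N \<rightarrow>\<^sub>M (\<Pi>\<^sub>M r\<in>observed \<tau> n. borel)"
      by (intro measurable_restrict x) (simp add: observed_def)
    show ?thesis using x[of n] unfolding Suc closed_loop_state.simps by measurable
  qed
qed

lemma measurable_closed_loop_input:
  assumes \<mu>: "control_policy \<tau> \<mu>"
    and w: "\<And>r. r < t \<Longrightarrow> w r \<in> borel_measurable N"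
  shows "(\<lambda>\<omega>. closed_loop_input A B x0 \<tau> \<mu> (\<lambda>r. w r \<omega>) t) \<in> borel_measurable N"
proof -
  have [measurable]: "\<mu> t \<in> (\<Pi>\<^sub>M r\<in>observed \<tau> t. borel) \<rightarrow>\<^sub>M borel"
    using \<mu> by (simp add: control_policy_def)
  have [measurable]: "(\<lambda>\<omega>. \<lambda>r\<in>observed \<tau> t. closed_loop_state A B x0 \<tau> \<mu> (\<lambda>r. w r \<omega>) r)
      \<in> N \<rightarrow>\<^sub>M (\<Pi>\<^sub>M r\<in>observed \<tau> t. borel)"
    by (intro measurable_restrict measurable_closed_loop_state \<mu> w) (simp add: observed_def)
  show ?thesis unfolding closed_loop_input_def by measurable
qed

lemma closed_loop_state_Suc:
  "closed_loop_state A B x0 \<tau> \<mu> w (Suc t) = A *v closed_loop_state A B x0 \<tau> \<mu> w t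
     + B *v closed_loop_input A B x0 \<tau> \<mu> w t + w t"
  by (simp add: closed_loop_input_def)

declare closed_loop_state.simps(2) [simp del]

text \<open>Running the loop with the noise switched off from the last sampling time on gives the
  prediction of the current state from the available information. It stands in for a conditional
  expectation.\<close>

definition truncate_noise :: "nat \<Rightarrow> (nat \<Rightarrow> 'v::zero) \<Rightarrow> nat \<Rightarrow> 'v" where
  "truncate_noise s w = (\<lambda>r. if r < s then w r else 0)"

text \<open>The prediction error \<open>a\<close> steps after \<open>s\<close>. There is no input
  term: the inputs of the true and the truncated loop agree until the next sample.\<close>

primrec noise_response :: "real^'n^'n \<Rightarrow> (nat \<Rightarrow> real^'n) \<Rightarrow> nat \<Rightarrow> nat \<Rightarrow> real^'n" where
  "noise_response A w s 0 = 0"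
| "noise_response A w s (Suc a) = A *v noise_response A w s a + w (s + a)"

text \<open>The input at \<open>m\<close> sees only states up to the last sampling time, and by
  causality these depend only on the noise before it.\<close>

lemma closed_loop_input_truncate:
  assumes "last_sample \<tau> t \<le> m" "m \<le> t"
  shows "closed_loop_input A B x0 \<tau> \<mu> w m =
    closed_loop_input A B x0 \<tau> \<mu> (truncate_noise (last_sample \<tau> t) w) m"
proof -
  have "closed_loop_state A B x0 \<tau> \<mu> w r
      = closed_loop_state A B x0 \<tau> \<mu> (truncate_noise (last_sample \<tau> t) w) r"
    if "r \<in> observed \<tau> m" for r
    using observed_le_last_sample[OF that] observed_after_last_sample[OF assms]
    by (intro closed_loop_state_cong) (simp add: truncate_noise_def)
  then show ?thesis unfolding closed_loop_input_def by (simp cong: restrict_cong)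
qed

text \<open>Since the inputs coincide, the difference of the two trajectories obeys the uncontrolled
  dynamics, starting from 0 at the sampling time.\<close>

lemma closed_loop_state_truncate:
  fixes A :: "real^'n^'n" and \<tau> :: "nat list" and t :: nat
  defines "s \<equiv> last_sample \<tau> t"
  assumes "s + a \<le> t"
  shows "closed_loop_state A B x0 \<tau> \<mu> w (s + a) =
    closed_loop_state A B x0 \<tau> \<mu> (truncate_noise s w) (s + a) + noise_response A w s a"
  using assms(2)
proof (induction a)
  case 0
  show ?case by (simp, intro closed_loop_state_cong) (simp add: truncate_noise_def)
next
  case (Suc a)
  have "closed_loop_input A B x0 \<tau> \<mu> w (s + a) =
      closed_loop_input A B x0 \<tau> \<mu> (truncate_noise s w) (s + a)"
    using Suc.prems unfolding s_def by (intro closed_loop_input_truncate) auto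
  moreover have "truncate_noise s w (s + a) = 0" by (simp add: truncate_noise_def)
  ultimately show ?case
    using Suc by (simp add: closed_loop_state_Suc matrix_vector_right_distrib)
qed

lemma closed_loop_state_age:
  "closed_loop_state A B x0 \<tau> \<mu> w t =
    closed_loop_state A B x0 \<tau> \<mu> (truncate_noise (last_sample \<tau> t) w) t
      + noise_response A w (last_sample \<tau> t) (age \<tau> t)"
  using closed_loop_state_truncate[of \<tau> t "age \<tau> t" A B x0 \<mu> w] last_sample_le[of \<tau> t]
  by (simp add: age_def)

text \<open>Certainty equivalence: the last sample is propagated by A - BK, since between samples
  the controller knows its own inputs, and the prediction is fed back through K.\<close>

definition feedback_policy ::
  "real^'n^'n \<Rightarrow> real^'m^'n \<Rightarrow> real^'n^'m \<Rightarrow> nat list \<Rightarrow> nat \<Rightarrow> (nat \<Rightarrow> real^'n) \<Rightarrow> real^'m" where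
  "feedback_policy A B K \<tau> t y =
     - (K *v (((*v) (A - B ** K) ^^ age \<tau> t) (y (last_sample \<tau> t))))"

lemma control_policy_feedback: "control_policy \<tau> (feedback_policy A B K \<tau>)"
  unfolding control_policy_def
proof
  fix t
  have [measurable]: "(\<lambda>y. y (last_sample \<tau> t)) \<in> (\<Pi>\<^sub>M r\<in>observed \<tau> t. borel) \<rightarrow>\<^sub>M borel"
    by (intro measurable_component_singleton last_sample_in_observed)
  have [measurable]: "((*v) (A - B ** K) ^^ a) \<in> borel_measurable borel" for a
    by (induction a) (auto intro!: measurable_comp measurable_matrix_vector_mult simp: id_def)
  show "feedback_policy A B K \<tau> t \<in> (\<Pi>\<^sub>M r\<in>observed \<tau> t. borel) \<rightarrow>\<^sub>M borel"
    unfolding feedback_policy_def by measurable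
qed

text \<open>Without noise after the last sample the loop itself follows the powers of A - BK, so the
  predictor inside the policy is the truncated state.\<close>

lemma closed_loop_input_feedback:
  fixes A :: "real^'n^'n"
  shows "closed_loop_input A B x0 \<tau> (feedback_policy A B K \<tau>) w t =
    - (K *v closed_loop_state A B x0 \<tau> (feedback_policy A B K \<tau>)
              (truncate_noise (last_sample \<tau> t) w) t)"
proof -
  define s where "s = last_sample \<tau> t"
  let ?x = "closed_loop_state A B x0 \<tau> (feedback_policy A B K \<tau>) (truncate_noise s w)"
  let ?u = "closed_loop_input A B x0 \<tau> (feedback_policy A B K \<tau>) (truncate_noise s w)"
  have u: "?u (s + a) = - (K *v (((*v) (A - B ** K) ^^ a) (?x s)))" if "s + a \<le> t" for a
  proof -
    have "last_sample \<tau> (s + a) = s"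
      using that observed_after_last_sample[of \<tau> t "s + a"] by (simp add: s_def)
    then show ?thesis
      using last_sample_in_observed[of \<tau> "s + a"]
      by (simp add: closed_loop_input_def feedback_policy_def age_def)
  qed
  have x: "?x (s + a) = ((*v) (A - B ** K) ^^ a) (?x s)" if "s + a \<le> t" for a
    using that
  proof (induction a)
    case 0
    show ?case by simp
  next
    case (Suc a)
    have "A *v y + B *v (- (K *v y)) = (A - B ** K) *v y" for y
      by (simp add: matrix_vector_mult_diff_rdistrib matrix_vector_mul_assoc
          linear_neg[OF matrix_vector_mul_linear])
    then show ?case
      using Suc u[of a] by (simp add: closed_loop_state_Suc truncate_noise_def)
  qed
  have "s \<le> t" by (simp add: s_def last_sample_le)
  then show ?thesis
    using u[of "t - s"] x[of "t - s"]
      closed_loop_input_truncate[of \<tau> t t A B x0 "feedback_policy A B K \<tau>" w]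
    by (simp add: s_def)
qed

subsection \<open>Independent zero-mean noise\<close>

lemma average_ge_lim:
  fixes X :: "nat \<Rightarrow> ennreal"
  assumes "X \<longlonglongrightarrow> c" "L \<longlonglongrightarrow> a" "\<And>T. 0 < T \<Longrightarrow> ennreal (L T) \<le> X T"
  shows "ennreal a \<le> c"
proof (rule LIMSEQ_le[OF tendsto_ennrealI[OF assms(2)] assms(1)])
  show "\<exists>N. \<forall>n\<ge>N. ennreal (L n) \<le> X n" using assms(3) by (intro exI[of _ 1]) auto
qed

context prob_space
begin

definition square_integrable :: "('a \<Rightarrow> 'b::euclidean_space) \<Rightarrow> bool" where
  "square_integrable X \<longleftrightarrow> X \<in> borel_measurable M \<and> integrable M (\<lambda>\<omega>. (norm (X \<omega>))\<^sup>2)"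

lemma square_integrable_measurable: "square_integrable X \<Longrightarrow> X \<in> borel_measurable M"
  by (simp add: square_integrable_def)

lemma square_integrable_bound:
  assumes "square_integrable X" "Y \<in> borel_measurable M" "\<And>\<omega>. norm (Y \<omega>) \<le> c * norm (X \<omega>)"
  shows "square_integrable Y"
proof -
  have "(norm (Y \<omega>))\<^sup>2 \<le> c\<^sup>2 * (norm (X \<omega>))\<^sup>2" for \<omega>
    using power_mono[OF assms(3)[of \<omega>], of 2] by (simp add: power_mult_distrib)
  moreover have "integrable M (\<lambda>\<omega>. c\<^sup>2 * (norm (X \<omega>))\<^sup>2)"
    using assms(1) by (simp add: square_integrable_def)
  moreover have "(\<lambda>\<omega>. (norm (Y \<omega>))\<^sup>2) \<in> borel_measurable M" using assms(2) by measurable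
  ultimately have "integrable M (\<lambda>\<omega>. (norm (Y \<omega>))\<^sup>2)"
    by (elim Bochner_Integration.integrable_bound) auto
  then show ?thesis using assms(2) by (simp add: square_integrable_def)
qed

lemma square_integrable_const [simp]: "square_integrable (\<lambda>\<omega>. c)"
  by (simp add: square_integrable_def)

lemma square_integrable_add:
  assumes X: "square_integrable X" and Y: "square_integrable Y"
  shows "square_integrable (\<lambda>\<omega>. X \<omega> + Y \<omega>)"
proof -
  have "(norm (X \<omega> + Y \<omega>))\<^sup>2 \<le> 2 * (norm (X \<omega>))\<^sup>2 + 2 * (norm (Y \<omega>))\<^sup>2" for \<omega>
  proof -
    have "(norm (X \<omega> + Y \<omega>))\<^sup>2 \<le> (norm (X \<omega>) + norm (Y \<omega>))\<^sup>2"
      by (intro power_mono norm_triangle_ineq) simp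
    also have "\<dots> \<le> 2 * (norm (X \<omega>))\<^sup>2 + 2 * (norm (Y \<omega>))\<^sup>2"
      using sum_squares_bound[of "norm (X \<omega>)" "norm (Y \<omega>)"] by (simp add: power2_sum)
    finally show ?thesis .
  qed
  moreover have "integrable M (\<lambda>\<omega>. 2 * (norm (X \<omega>))\<^sup>2 + 2 * (norm (Y \<omega>))\<^sup>2)"
    using X Y by (simp add: square_integrable_def)
  moreover have m: "(\<lambda>\<omega>. X \<omega> + Y \<omega>) \<in> borel_measurable M"
    using X Y by (intro borel_measurable_add square_integrable_measurable)
  moreover from m have "(\<lambda>\<omega>. (norm (X \<omega> + Y \<omega>))\<^sup>2) \<in> borel_measurable M" by measurable
  ultimately have "integrable M (\<lambda>\<omega>. (norm (X \<omega> + Y \<omega>))\<^sup>2)"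
    by (elim Bochner_Integration.integrable_bound) auto
  then show ?thesis using m by (simp add: square_integrable_def)
qed

lemma square_integrable_matrix:
  fixes X :: "'a \<Rightarrow> real^'n" and S :: "real^'n^'m"
  assumes "square_integrable X"
  shows "square_integrable (\<lambda>\<omega>. S *v X \<omega>)"
proof (rule square_integrable_bound[OF assms])
  show "(\<lambda>\<omega>. S *v X \<omega>) \<in> borel_measurable M"
    using square_integrable_measurable[OF assms] by measurable
  show "norm (S *v X \<omega>) \<le> onorm ((*v) S) * norm (X \<omega>)" for \<omega>
    by (intro onorm linear_conv_bounded_linear[THEN iffD1] matrix_vector_mul_linear)
qed

lemma square_integrable_uminus: "square_integrable X \<Longrightarrow> square_integrable (\<lambda>\<omega>. - X \<omega>)"
  by (simp add: square_integrable_def)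

lemma square_integrable_diff:
  "square_integrable X \<Longrightarrow> square_integrable Y \<Longrightarrow> square_integrable (\<lambda>\<omega>. X \<omega> - Y \<omega>)"
  using square_integrable_add[OF _ square_integrable_uminus] by fastforce

lemma square_integrable_inner:
  assumes X: "square_integrable X" and Y: "square_integrable Y"
  shows "integrable M (\<lambda>\<omega>. X \<omega> \<bullet> Y \<omega>)"
proof (rule Bochner_Integration.integrable_bound)
  show "integrable M (\<lambda>\<omega>. (norm (X \<omega>))\<^sup>2 + (norm (Y \<omega>))\<^sup>2)"
    using X Y by (simp add: square_integrable_def)
  show "(\<lambda>\<omega>. X \<omega> \<bullet> Y \<omega>) \<in> borel_measurable M"
    using X Y by (intro borel_measurable_inner square_integrable_measurable)
  have "\<bar>x \<bullet> y\<bar> \<le> (norm x)\<^sup>2 + (norm y)\<^sup>2" for x y :: 'b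
    using Cauchy_Schwarz_ineq2[of x y] sum_squares_bound[of "norm x" "norm y"]
      mult_nonneg_nonneg[OF norm_ge_zero norm_ge_zero, of x y] by linarith
  then show "AE \<omega> in M. norm (X \<omega> \<bullet> Y \<omega>) \<le> norm ((norm (X \<omega>))\<^sup>2 + (norm (Y \<omega>))\<^sup>2)" by simp
qed

lemma square_integrable_integrable:
  assumes "square_integrable X"
  shows "integrable M X"
proof (rule Bochner_Integration.integrable_bound)
  show "integrable M (\<lambda>\<omega>. 1 + (norm (X \<omega>))\<^sup>2)"
    using assms by (simp add: square_integrable_def)
  have "norm x \<le> 1 + (norm x)\<^sup>2" for x :: 'b
    using sum_squares_bound[of "norm x" 1, simplified] zero_le_power2[of "norm x"] by linarith
  then show "AE \<omega> in M. norm (X \<omega>) \<le> norm (1 + (norm (X \<omega>))\<^sup>2)" by simp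
qed (use assms in \<open>simp add: square_integrable_def\<close>)

lemma square_integrable_quadratic_form:
  fixes X :: "'a \<Rightarrow> real^'n" and Y :: "'a \<Rightarrow> real^'m" and S :: "real^'m^'n"
  shows "square_integrable X \<Longrightarrow> square_integrable Y \<Longrightarrow> integrable M (\<lambda>\<omega>. X \<omega> \<bullet> (S *v Y \<omega>))"
  by (intro square_integrable_inner square_integrable_matrix)

lemma expectation_quadratic_form_add:
  fixes X Y :: "'a \<Rightarrow> real^'n" and S :: "real^'n^'n"
  assumes "square_integrable X" "square_integrable Y" "transpose S = S"
    and "(\<integral>\<omega>. X \<omega> \<bullet> (S *v Y \<omega>) \<partial>M) = 0"
  shows "(\<integral>\<omega>. (X \<omega> + Y \<omega>) \<bullet> (S *v (X \<omega> + Y \<omega>)) \<partial>M)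
    = (\<integral>\<omega>. X \<omega> \<bullet> (S *v X \<omega>) \<partial>M) + (\<integral>\<omega>. Y \<omega> \<bullet> (S *v Y \<omega>) \<partial>M)"
  using assms(4) unfolding quadratic_form_add[OF assms(3)]
  by (simp add: square_integrable_quadratic_form assms(1,2))

end

locale noise = prob_space M for M :: "'a measure" +
  fixes w :: "nat \<Rightarrow> 'a \<Rightarrow> real^'n" and W :: "real^'n^'n"
  assumes noise_indep: "indep_vars (\<lambda>_. borel) w UNIV"
    and noise_mean: "\<And>t. has_bochner_integral M (w t) 0"
    and noise_covariance: "\<And>t. has_bochner_integral M (\<lambda>\<omega>. \<chi> a b. w t \<omega> $ a * w t \<omega> $ b) W"
begin

text \<open>Stated as a factorization through coordinates of the noise, so that disjoint index sets
  give independent variables directly from \<open>indep_var_restrict\<close>.\<close>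

definition noise_determined :: "nat set \<Rightarrow> ('a \<Rightarrow> real^'m) \<Rightarrow> bool" where
  "noise_determined I X \<longleftrightarrow>
     (\<exists>F \<in> (\<Pi>\<^sub>M r\<in>I. borel) \<rightarrow>\<^sub>M borel. \<forall>\<omega>. X \<omega> = F (\<lambda>r\<in>I. w r \<omega>))"

text \<open>This is tr(S W), since the covariance W is symmetric.\<close>

definition noise_cost :: "real^'n^'n \<Rightarrow> real" where
  "noise_cost S = (\<Sum>a\<in>UNIV. \<Sum>b\<in>UNIV. S $ a $ b * W $ a $ b)"

text \<open>Moving the powers of A onto W gives tr(S (W + A W A^T + ...)) with \<open>a\<close>
  summands. For S = Z this is the inner part of beta, the function g.\<close>

definition estimation_cost :: "real^'n^'n \<Rightarrow> real^'n^'n \<Rightarrow> nat \<Rightarrow> real" where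
  "estimation_cost A S a = (\<Sum>r<a. noise_cost (((\<lambda>S. transpose A ** S ** A) ^^ r) S))"

lemma noise_measurable [measurable]: "w t \<in> borel_measurable M"
  using noise_mean[of t] by (rule borel_measurable_has_bochner_integral)

lemma noise_moment: "has_bochner_integral M (\<lambda>\<omega>. w t \<omega> $ a * w t \<omega> $ b) (W $ a $ b)"
  using has_bochner_integral_bounded_linear[OF bounded_linear_vec_nth
      has_bochner_integral_bounded_linear[OF bounded_linear_vec_nth noise_covariance]]
  by simp

lemma square_integrable_noise: "square_integrable (w t)"
proof -
  have "(\<lambda>\<omega>. (norm (w t \<omega>))\<^sup>2) = (\<lambda>\<omega>. \<Sum>a\<in>UNIV. w t \<omega> $ a * w t \<omega> $ a)"
    by (simp add: power2_norm_eq_inner inner_vec_def)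
  then show ?thesis
    using has_bochner_integral_integrable noise_moment[of t]
    by (auto simp: square_integrable_def has_bochner_integral_iff)
qed

lemma expectation_noise_cost: "(\<integral>\<omega>. w t \<omega> \<bullet> (S *v w t \<omega>) \<partial>M) = noise_cost S"
proof -
  have "has_bochner_integral M (\<lambda>\<omega>. \<Sum>a\<in>UNIV. \<Sum>b\<in>UNIV. S $ a $ b * (w t \<omega> $ a * w t \<omega> $ b))
    (noise_cost S)"
    unfolding noise_cost_def
    by (intro has_bochner_integral_sum has_bochner_integral_mult_right noise_moment)
  moreover have "(\<Sum>a\<in>UNIV. \<Sum>b\<in>UNIV. S $ a $ b * (w t \<omega> $ a * w t \<omega> $ b))
      = w t \<omega> \<bullet> (S *v w t \<omega>)" for \<omega>
    by (simp add: inner_vec_def matrix_vector_mult_def sum_distrib_left ac_simps)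
  ultimately show ?thesis by (simp add: has_bochner_integral_iff)
qed

text \<open>The trace of a product becomes visibly nonnegative when read as the expectation of a
  quadratic form in the noise.\<close>

lemma noise_cost_nonneg:
  assumes "positive_semidefinite S"
  shows "0 \<le> noise_cost S"
  unfolding expectation_noise_cost[of 0, symmetric]
  using assms by (intro integral_nonneg_AE) (auto simp: positive_semidefinite_def)

lemma noise_cost_tendsto [tendsto_intros]:
  "(X \<longlongrightarrow> S) F \<Longrightarrow> ((\<lambda>k. noise_cost (X k)) \<longlongrightarrow> noise_cost S) F"
  unfolding noise_cost_def by (intro tendsto_intros)

lemma estimation_cost_tendsto [tendsto_intros]:
  assumes "(X \<longlongrightarrow> S) F"
  shows "((\<lambda>k. estimation_cost A (X k) a) \<longlongrightarrow> estimation_cost A S a) F"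
proof -
  have "((\<lambda>k. ((\<lambda>S. transpose A ** S ** A) ^^ r) (X k)) \<longlongrightarrow>
      ((\<lambda>S. transpose A ** S ** A) ^^ r) S) F" for r
    by (induction r) (auto intro!: tendsto_intros assms)
  then show ?thesis unfolding estimation_cost_def by (intro tendsto_intros)
qed

text \<open>Splitting off \<open>r = 0\<close> follows the recursion of
  \<open>noise_response\<close>: the newest noise enters directly, while all older noise passes
  through A once more, which turns the weight into A^T S A.\<close>

lemma estimation_cost_Suc:
  "estimation_cost A S (Suc a) = noise_cost S + estimation_cost A (transpose A ** S ** A) a"
  unfolding estimation_cost_def sum.lessThan_Suc_shift 
  by (simp add: funpow_Suc_right del: funpow.simps(2))

context
  fixes A S :: "real^'n^'n"
  assumes psd: "positive_semidefinite S"
begin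

lemma congruence_power_noise_cost_nonneg: "0 \<le> noise_cost (((\<lambda>S. transpose A ** S ** A) ^^ r) S)"
proof -
  have "positive_semidefinite (((\<lambda>S. transpose A ** S ** A) ^^ r) S)"
    by (induction r) (auto intro: psd positive_semidefinite_congruence)
  then show ?thesis by (rule noise_cost_nonneg)
qed

lemma estimation_cost_nonneg: "0 \<le> estimation_cost A S a"
  unfolding estimation_cost_def
  by (intro sum_nonneg congruence_power_noise_cost_nonneg)

lemma estimation_cost_mono: "mono (estimation_cost A S)"
  unfolding estimation_cost_def
  by (intro monoI sum_mono2) (auto intro: congruence_power_noise_cost_nonneg)

end

section \<open>Variables determined by disjoint sets of noise times\<close>

lemma noise_determined_measurable:
  assumes "noise_determined I X" and [measurable]: "f \<in> borel_measurable borel"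
  shows "noise_determined I (\<lambda>\<omega>. f (X \<omega>))"
proof -
  obtain F where [measurable]: "F \<in> (\<Pi>\<^sub>M r\<in>I. borel) \<rightarrow>\<^sub>M borel"
    and "\<And>\<omega>. X \<omega> = F (\<lambda>r\<in>I. w r \<omega>)"
    using assms(1) unfolding noise_determined_def by blast
  then show ?thesis
    unfolding noise_determined_def by (intro bexI[of _ "\<lambda>v. f (F v)"]) auto
qed

lemma noise_determined_add:
  assumes "noise_determined I X" "noise_determined I Y"
  shows "noise_determined I (\<lambda>\<omega>. X \<omega> + Y \<omega>)"
proof -
  obtain F G where [measurable]: "F \<in> (\<Pi>\<^sub>M r\<in>I. borel) \<rightarrow>\<^sub>M borel" "G \<in> (\<Pi>\<^sub>M r\<in>I. borel) \<rightarrow>\<^sub>M borel"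
    and "\<And>\<omega>. X \<omega> = F (\<lambda>r\<in>I. w r \<omega>)" "\<And>\<omega>. Y \<omega> = G (\<lambda>r\<in>I. w r \<omega>)"
    using assms unfolding noise_determined_def by blast
  then show ?thesis
    unfolding noise_determined_def by (intro bexI[of _ "\<lambda>v. F v + G v"]) auto
qed

lemma noise_determined_mult:
  "noise_determined I X \<Longrightarrow> noise_determined I (\<lambda>\<omega>. S *v X \<omega>)"
  by (rule noise_determined_measurable[OF _ measurable_matrix_vector_mult])

text \<open>Coordinates of X and Y are independent, so each product of coordinates has expectation
  E[X_k] * 0.\<close>

lemma expectation_inner_eq_0:
  fixes X Y :: "'a \<Rightarrow> real^'m"
  assumes X: "noise_determined I X" "integrable M X"
    and Y: "noise_determined J Y" "has_bochner_integral M Y 0"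
    and "I \<inter> J = {}"
  shows "(\<integral>\<omega>. X \<omega> \<bullet> Y \<omega> \<partial>M) = 0"
proof -
  obtain F G where F: "F \<in> (\<Pi>\<^sub>M r\<in>I. borel) \<rightarrow>\<^sub>M borel" "\<And>\<omega>. X \<omega> = F (\<lambda>r\<in>I. w r \<omega>)"
    and G: "G \<in> (\<Pi>\<^sub>M r\<in>J. borel) \<rightarrow>\<^sub>M borel" "\<And>\<omega>. Y \<omega> = G (\<lambda>r\<in>J. w r \<omega>)"
    using X(1) Y(1) unfolding noise_determined_def by blast
  have comp: "has_bochner_integral M (\<lambda>\<omega>. X \<omega> $ k * Y \<omega> $ k) 0" for k
  proof -
    have "(\<lambda>x. x $ k) \<in> borel_measurable (borel :: (real^'m) measure)"
      by (intro borel_measurable_continuous_onI continuous_intros)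
    then have [measurable]: "(\<lambda>v. F v $ k) \<in> (\<Pi>\<^sub>M r\<in>I. borel) \<rightarrow>\<^sub>M borel"
        "(\<lambda>v. G v $ k) \<in> (\<Pi>\<^sub>M r\<in>J. borel) \<rightarrow>\<^sub>M borel"
      by (auto intro: measurable_compose[OF F(1)] measurable_compose[OF G(1)])
    have "indep_var borel ((\<lambda>v. F v $ k) \<circ> (\<lambda>\<omega>. \<lambda>r\<in>I. w r \<omega>))
        borel ((\<lambda>v. G v $ k) \<circ> (\<lambda>\<omega>. \<lambda>r\<in>J. w r \<omega>))"
      by (rule indep_var_compose[OF indep_var_restrict[OF noise_indep \<open>I \<inter> J = {}\<close>]]) simp_all
    then have indep: "indep_var borel (\<lambda>\<omega>. X \<omega> $ k) borel (\<lambda>\<omega>. Y \<omega> $ k)"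
      by (simp add: F(2) G(2) comp_def)
    have iX: "integrable M (\<lambda>\<omega>. X \<omega> $ k)"
      by (rule integrable_bounded_linear[OF bounded_linear_vec_nth X(2)])
    have iY: "has_bochner_integral M (\<lambda>\<omega>. Y \<omega> $ k) 0"
      using has_bochner_integral_bounded_linear[OF bounded_linear_vec_nth Y(2)] by simp
    show ?thesis
      using indep_var_lebesgue_integral[OF indep iX] indep_var_integrable[OF indep iX] iY
      by (simp add: has_bochner_integral_iff)
  qed
  have "has_bochner_integral M (\<lambda>\<omega>. \<Sum>k\<in>UNIV. X \<omega> $ k * Y \<omega> $ k) (\<Sum>k\<in>(UNIV::'m set). 0)"
    by (intro has_bochner_integral_sum comp)
  then show ?thesis by (simp add: has_bochner_integral_iff inner_vec_def)
qed

lemma has_bochner_integral_matrix_0: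
  fixes Y :: "'a \<Rightarrow> real^'p" and S :: "real^'p^'m"
  assumes "has_bochner_integral M Y 0"
  shows "has_bochner_integral M (\<lambda>\<omega>. S *v Y \<omega>) 0"
  using has_bochner_integral_bounded_linear[OF
      linear_conv_bounded_linear[THEN iffD1, OF matrix_vector_mul_linear[of S]] assms]
  by simp

lemma expectation_quadratic_eq_0:
  fixes X :: "'a \<Rightarrow> real^'m" and Y :: "'a \<Rightarrow> real^'p" and S :: "real^'p^'m"
  assumes "noise_determined I X" "square_integrable X"
    and "noise_determined J Y" "has_bochner_integral M Y 0"
    and "I \<inter> J = {}"
  shows "(\<integral>\<omega>. X \<omega> \<bullet> (S *v Y \<omega>) \<partial>M) = 0"
  using assms
  by (intro expectation_inner_eq_0 square_integrable_integrable noise_determined_mult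
      has_bochner_integral_matrix_0)

lemma noise_determined_noise:
  assumes "t \<in> I"
  shows "noise_determined I (w t)"
  unfolding noise_determined_def using assms
  by (intro bexI[of _ "\<lambda>v. v t"]) auto

context
  fixes A :: "real^'n^'n" and s :: nat
begin

text \<open>The right end \<open>b\<close> stays fixed during the induction, so that the old
  response and the new noise are determined by one index set.\<close>

lemma noise_determined_response:
  "s + a \<le> b \<Longrightarrow> noise_determined {s..<b} (\<lambda>\<omega>. noise_response A (\<lambda>r. w r \<omega>) s a)"
proof (induction a)
  case 0
  show ?case unfolding noise_determined_def by (intro bexI[of _ "\<lambda>_. 0"]) auto
next
  case (Suc a)
  then show ?case
    by (auto intro!: noise_determined_add noise_determined_mult noise_determined_noise)
qed

lemma square_integrable_response: "square_integrable (\<lambda>\<omega>. noise_response A (\<lambda>r. w r \<omega>) s a)"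
  by (induction a)
    (auto intro: square_integrable_add square_integrable_matrix square_integrable_noise)

lemma mean_response: "has_bochner_integral M (\<lambda>\<omega>. noise_response A (\<lambda>r. w r \<omega>) s a) 0"
proof (induction a)
  case 0
  show ?case by (simp add: has_bochner_integral_iff)
next
  case (Suc a)
  show ?case
    using has_bochner_integral_add[OF has_bochner_integral_matrix_0[OF Suc, of A] noise_mean[of "s + a"]]
    by simp
qed

text \<open>The newest noise is uncorrelated with the response to the earlier noise.
  \<open>S\<close> is arbitrary in the induction because the older part is weighed by A^T S
  A.\<close>

lemma expectation_response:
  "transpose S = S \<Longrightarrow>
    (\<integral>\<omega>. noise_response A (\<lambda>r. w r \<omega>) s a \<bullet> (S *v noise_response A (\<lambda>r. w r \<omega>) s a) \<partial>M)
      = estimation_cost A S a"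
proof (induction a arbitrary: S)
  case 0
  show ?case by (simp add: estimation_cost_def)
next
  case (Suc a)
  have "(\<integral>\<omega>. (A *v noise_response A (\<lambda>r. w r \<omega>) s a) \<bullet> (S *v w (s + a) \<omega>) \<partial>M) = 0"
    by (rule expectation_quadratic_eq_0[where I = "{s..<s + a}" and J = "{s + a}"])
      (auto intro: noise_determined_mult noise_determined_response square_integrable_matrix
        square_integrable_response noise_determined_noise noise_mean)
  then show ?case
    using Suc.IH[OF transpose_congruence[OF Suc.prems, of A]]
    by (simp add: expectation_quadratic_form_add square_integrable_matrix square_integrable_response
        square_integrable_noise Suc.prems expectation_noise_cost estimation_cost_Suc
        flip: quadratic_form_congruence)
qed

end

end

subsection \<open>The optimal average cost\<close>

lemma (in noise) noise_determined_mono: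
  assumes "noise_determined I X" "I \<subseteq> J"
  shows "noise_determined J X"
proof -
  obtain F where F: "F \<in> (\<Pi>\<^sub>M r\<in>I. borel) \<rightarrow>\<^sub>M borel" "\<And>\<omega>. X \<omega> = F (\<lambda>r\<in>I. w r \<omega>)"
    using assms(1) unfolding noise_determined_def by blast
  have "(\<lambda>v. F (restrict v I)) \<in> (\<Pi>\<^sub>M r\<in>J. borel) \<rightarrow>\<^sub>M borel"
    by (rule measurable_compose[OF measurable_restrict_subset[OF assms(2)] F(1)])
  moreover have "restrict (\<lambda>r\<in>J. w r \<omega>) I = (\<lambda>r\<in>I. w r \<omega>)" for \<omega>
    using assms(2) by (auto simp: restrict_def fun_eq_iff)
  ultimately show ?thesis
    unfolding noise_determined_def using F(2) by (intro bexI[of _ "\<lambda>v. F (restrict v I)"]) auto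
qed

locale lq_control = linear_quadratic A B C D + noise M w W
  for A :: "real^'n^'n" and B :: "real^'m^'n" and C :: "real^'n^'k" and D :: "real^'m^'k"
    and M :: "'a measure" and w :: "nat \<Rightarrow> 'a \<Rightarrow> real^'n" and W :: "real^'n^'n" +
  fixes x0 :: "real^'n"
  assumes controllable: "controllable A B"
begin

abbreviation "state \<tau> \<mu> t \<omega> \<equiv> closed_loop_state A B x0 \<tau> \<mu> (\<lambda>s. w s \<omega>) t"

abbreviation "input \<tau> \<mu> t \<omega> \<equiv> closed_loop_input A B x0 \<tau> \<mu> (\<lambda>s. w s \<omega>) t"

abbreviation "estimate \<tau> \<mu> t \<omega> \<equiv>
  closed_loop_state A B x0 \<tau> \<mu> (truncate_noise (last_sample \<tau> t) (\<lambda>s. w s \<omega>)) t"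

abbreviation "stage_cost \<tau> \<mu> t \<omega> \<equiv> (norm (closed_loop_output A B C D x0 \<tau> \<mu> (\<lambda>s. w s \<omega>) t))\<^sup>2"

text \<open>The formula tr(PW) + (1/h) sum of beta, with \<open>value_limit\<close> as P. The
  summand at age 0 vanishes, in accordance with beta(1) = 0.\<close>

definition optimal_rate :: "nat list \<Rightarrow> real" where
  "optimal_rate \<tau> = noise_cost value_limit +
     (\<Sum>k<length \<tau>. \<Sum>a<\<tau> ! k. estimation_cost A (estimation_weight value_limit) a)
       / real (schedule.period \<tau>)"

context
  fixes \<tau> :: "nat list" and \<mu> :: "nat \<Rightarrow> (nat \<Rightarrow> real^'n) \<Rightarrow> real^'m"
  assumes policy: "control_policy \<tau> \<mu>"
begin

lemma measurable_truncate_noise: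
  "(\<lambda>v. truncate_noise s v r) \<in> borel_measurable (\<Pi>\<^sub>M r\<in>{..<s}. (borel :: (real^'n) measure))"
  unfolding truncate_noise_def by (cases "r < s") (auto intro: measurable_component_singleton)

lemma truncate_noise_restrict: "truncate_noise s (\<lambda>r\<in>{..<s}. v r) = truncate_noise s v"
  by (auto simp: truncate_noise_def)

text \<open>The truncated loop reads only the noise before \<open>s\<close>, so as a function on
  noise paths it is itself the required factor.\<close>

lemma noise_determined_truncated_state:
  "noise_determined {..<s} (\<lambda>\<omega>. closed_loop_state A B x0 \<tau> \<mu> (truncate_noise s (\<lambda>r. w r \<omega>)) t)"
  unfolding noise_determined_def
proof (intro bexI)
  show "(\<lambda>v. closed_loop_state A B x0 \<tau> \<mu> (\<lambda>r. truncate_noise s v r) t)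
      \<in> (\<Pi>\<^sub>M r\<in>{..<s}. borel) \<rightarrow>\<^sub>M borel"
    by (intro measurable_closed_loop_state policy measurable_truncate_noise)
qed (simp add: truncate_noise_restrict)

lemma noise_determined_input: "noise_determined {..<last_sample \<tau> t} (input \<tau> \<mu> t)"
  unfolding noise_determined_def
proof (intro bexI)
  let ?s = "last_sample \<tau> t"
  show "(\<lambda>v. closed_loop_input A B x0 \<tau> \<mu> (\<lambda>r. truncate_noise ?s v r) t)
      \<in> (\<Pi>\<^sub>M r\<in>{..<?s}. borel) \<rightarrow>\<^sub>M borel"
    by (intro measurable_closed_loop_input policy measurable_truncate_noise)
  show "\<forall>\<omega>. input \<tau> \<mu> t \<omega> =
      closed_loop_input A B x0 \<tau> \<mu> (\<lambda>r. truncate_noise ?s (\<lambda>r\<in>{..<?s}. w r \<omega>) r) t"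
    using closed_loop_input_truncate[OF last_sample_le order_refl]
    by (auto simp: truncate_noise_restrict)
qed

lemma noise_determined_state: "noise_determined {..<t} (state \<tau> \<mu> t)"
proof -
  have "closed_loop_state A B x0 \<tau> \<mu> (truncate_noise t v) t = closed_loop_state A B x0 \<tau> \<mu> v t"
    for v
    by (rule closed_loop_state_cong) (simp add: truncate_noise_def)
  then show ?thesis using noise_determined_truncated_state[of t t] by simp
qed

lemma state_decomposition:
  "state \<tau> \<mu> t \<omega> = estimate \<tau> \<mu> t \<omega>
    + noise_response A (\<lambda>r. w r \<omega>) (last_sample \<tau> t) (age \<tau> t)"
  by (rule closed_loop_state_age)

lemma measurable_input: "input \<tau> \<mu> t \<in> borel_measurable M"
  by (rule measurable_closed_loop_input[OF policy noise_measurable])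

lemma measurable_state: "state \<tau> \<mu> t \<in> borel_measurable M"
  by (rule measurable_closed_loop_state[OF policy noise_measurable])

lemma measurable_stage_cost: "stage_cost \<tau> \<mu> t \<in> borel_measurable M"
proof -
  note [measurable] = measurable_input measurable_state
  show ?thesis unfolding closed_loop_output_def by measurable
qed

context
  assumes inputs: "\<And>t. square_integrable (input \<tau> \<mu> t)"
begin

lemma square_integrable_state: "square_integrable (state \<tau> \<mu> t)"
  by (induction t)
    (auto simp: closed_loop_state_Suc
      intro!: square_integrable_add square_integrable_matrix square_integrable_noise inputs)

lemma square_integrable_estimate: "square_integrable (estimate \<tau> \<mu> t)"
proof -
  let ?e = "\<lambda>\<omega>. noise_response A (\<lambda>r. w r \<omega>) (last_sample \<tau> t) (age \<tau> t)"
  have "estimate \<tau> \<mu> t = (\<lambda>\<omega>. state \<tau> \<mu> t \<omega> - ?e \<omega>)"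
    by (simp add: fun_eq_iff state_decomposition)
  then show ?thesis
    by (simp add: square_integrable_diff square_integrable_state square_integrable_response)
qed

lemma integrable_stage_cost: "integrable M (stage_cost \<tau> \<mu> t)"
proof -
  have "square_integrable (\<lambda>\<omega>. C *v state \<tau> \<mu> t \<omega> + D *v input \<tau> \<mu> t \<omega>)"
    by (intro square_integrable_add square_integrable_matrix square_integrable_state inputs)
  then show ?thesis by (simp add: square_integrable_def closed_loop_output_def)
qed

text \<open>
  The deviation of the input from the state feedback splits into a part known at the last
  sampling time and the independent zero-mean response to the noise since then.
\<close>

lemma expectation_bellman:
  assumes psd: "positive_semidefinite S"
  shows "(\<integral>\<omega>. stage_cost \<tau> \<mu> t \<omega> \<partial>M) + (\<integral>\<omega>. state \<tau> \<mu> (Suc t) \<omega> \<bullet> (S *v state \<tau> \<mu> (Suc t) \<omega>) \<partial>M)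
    = (\<integral>\<omega>. state \<tau> \<mu> t \<omega> \<bullet> (riccati S *v state \<tau> \<mu> t \<omega>) \<partial>M)
      + (\<integral>\<omega>. (input \<tau> \<mu> t \<omega> + gain S *v estimate \<tau> \<mu> t \<omega>) \<bullet>
            (input_hessian S *v (input \<tau> \<mu> t \<omega> + gain S *v estimate \<tau> \<mu> t \<omega>)) \<partial>M)
      + noise_cost S + estimation_cost A (estimation_weight S) (age \<tau> t)"
proof -
  let ?x = "state \<tau> \<mu> t" and ?u = "input \<tau> \<mu> t"
  let ?y = "\<lambda>\<omega>. A *v ?x \<omega> + B *v ?u \<omega>"
  let ?e = "\<lambda>\<omega>. noise_response A (\<lambda>r. w r \<omega>) (last_sample \<tau> t) (age \<tau> t)"
  let ?d = "\<lambda>\<omega>. ?u \<omega> + gain S *v estimate \<tau> \<mu> t \<omega>" and ?f = "\<lambda>\<omega>. gain S *v ?e \<omega>"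
  have sym: "transpose S = S" using psd by (simp add: positive_semidefinite_def)
  have y: "square_integrable ?y"
    by (intro square_integrable_add square_integrable_matrix square_integrable_state inputs)
  have d: "square_integrable ?d"
    by (intro square_integrable_add square_integrable_matrix square_integrable_estimate inputs)
  have f: "square_integrable ?f"
    by (intro square_integrable_matrix square_integrable_response)
  \<comment> \<open>The last sampling time is at most \<open>t\<close>, so the input, and with it
    \<open>?y\<close>, is determined by noise before \<open>t\<close>; the cross term with
    \<open>w t\<close> vanishes.\<close>
  have "noise_determined {..<t} ?u"
    by (rule noise_determined_mono[OF noise_determined_input]) (simp add: last_sample_le)
  then have "noise_determined {..<t} ?y"
    by (intro noise_determined_add noise_determined_mult noise_determined_state)
  then have "(\<integral>\<omega>. ?y \<omega> \<bullet> (S *v w t \<omega>) \<partial>M) = 0"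
    by (rule expectation_quadratic_eq_0[OF _ y noise_determined_noise noise_mean, where J = "{t}"])
      auto
  then have next_state: "(\<integral>\<omega>. state \<tau> \<mu> (Suc t) \<omega> \<bullet> (S *v state \<tau> \<mu> (Suc t) \<omega>) \<partial>M) =
      (\<integral>\<omega>. ?y \<omega> \<bullet> (S *v ?y \<omega>) \<partial>M) + noise_cost S"
    by (simp add: closed_loop_state_Suc expectation_quadratic_form_add y square_integrable_noise sym
        expectation_noise_cost)
  have known: "noise_determined {..<last_sample \<tau> t} ?d"
    by (intro noise_determined_add noise_determined_mult noise_determined_input
        noise_determined_truncated_state)
  have resp: "noise_determined {last_sample \<tau> t..<t} ?f"
    by (intro noise_determined_mult noise_determined_response) (simp add: age_def last_sample_le)
  have "(\<integral>\<omega>. ?d \<omega> \<bullet> (input_hessian S *v ?f \<omega>) \<partial>M) = 0"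
    by (rule expectation_quadratic_eq_0[OF known d resp has_bochner_integral_matrix_0[OF mean_response]])
      auto
  then have "(\<integral>\<omega>. (?d \<omega> + ?f \<omega>) \<bullet> (input_hessian S *v (?d \<omega> + ?f \<omega>)) \<partial>M)
      = (\<integral>\<omega>. ?d \<omega> \<bullet> (input_hessian S *v ?d \<omega>) \<partial>M)
        + (\<integral>\<omega>. ?f \<omega> \<bullet> (input_hessian S *v ?f \<omega>) \<partial>M)"
    by (intro expectation_quadratic_form_add d f transpose_input_hessian psd)
  also have "(\<integral>\<omega>. ?f \<omega> \<bullet> (input_hessian S *v ?f \<omega>) \<partial>M)
      = estimation_cost A (estimation_weight S) (age \<tau> t)"
    using expectation_response[of "estimation_weight S"] positive_semidefinite_estimation_weight[OF psd]
    by (simp add: estimation_weight_def quadratic_form_congruence positive_semidefinite_def)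
  \<comment> \<open>Estimate plus response is the true state, so \<open>?d + ?f\<close> is the
    deviation that is squared in \<open>bellman_equation\<close>.\<close>
  also have "(\<lambda>\<omega>. ?d \<omega> + ?f \<omega>) = (\<lambda>\<omega>. ?u \<omega> + gain S *v ?x \<omega>)"
    by (simp add: fun_eq_iff state_decomposition matrix_vector_right_distrib add.assoc)
  finally have dev: "(\<integral>\<omega>. (?u \<omega> + gain S *v ?x \<omega>) \<bullet> (input_hessian S *v (?u \<omega> + gain S *v ?x \<omega>)) \<partial>M)
      = (\<integral>\<omega>. ?d \<omega> \<bullet> (input_hessian S *v ?d \<omega>) \<partial>M)
        + estimation_cost A (estimation_weight S) (age \<tau> t)" .
  have "(\<integral>\<omega>. stage_cost \<tau> \<mu> t \<omega> \<partial>M) + (\<integral>\<omega>. ?y \<omega> \<bullet> (S *v ?y \<omega>) \<partial>M)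
      = (\<integral>\<omega>. stage_cost \<tau> \<mu> t \<omega> + ?y \<omega> \<bullet> (S *v ?y \<omega>) \<partial>M)"
    by (intro Bochner_Integration.integral_add[symmetric] integrable_stage_cost
        square_integrable_quadratic_form y)
  also have "\<dots> = (\<integral>\<omega>. ?x \<omega> \<bullet> (riccati S *v ?x \<omega>)
      + (?u \<omega> + gain S *v ?x \<omega>) \<bullet> (input_hessian S *v (?u \<omega> + gain S *v ?x \<omega>)) \<partial>M)"
    by (simp add: closed_loop_output_def bellman_equation[OF psd])
  also have "\<dots> = (\<integral>\<omega>. ?x \<omega> \<bullet> (riccati S *v ?x \<omega>) \<partial>M)
      + (\<integral>\<omega>. (?u \<omega> + gain S *v ?x \<omega>) \<bullet> (input_hessian S *v (?u \<omega> + gain S *v ?x \<omega>)) \<partial>M)"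
    by (intro Bochner_Integration.integral_add square_integrable_quadratic_form
        square_integrable_add square_integrable_matrix square_integrable_state inputs)
  finally show ?thesis using next_state dev by simp
qed

text \<open>
  Comparing with the finite-horizon value matrices avoids a terminal cost, so no stability of the
  closed loop is needed.
\<close>

lemma expected_cost_ge:
  "(\<Sum>t<T. noise_cost (value_matrix (T - Suc t)) +
      estimation_cost A (estimation_weight (value_matrix (T - Suc t))) (age \<tau> t))
    \<le> (\<Sum>t<T. \<integral>\<omega>. stage_cost \<tau> \<mu> t \<omega> \<partial>M)"
proof -
  define V where "V k t = (\<integral>\<omega>. state \<tau> \<mu> t \<omega> \<bullet> (value_matrix k *v state \<tau> \<mu> t \<omega>) \<partial>M)" for k t
  have nonneg: "0 \<le> V k t" for k t
    unfolding V_def using positive_semidefinite_value_matrix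
    by (intro integral_nonneg_AE) (auto simp: positive_semidefinite_def)
  have step: "V (Suc k) t + (noise_cost (value_matrix k) +
      estimation_cost A (estimation_weight (value_matrix k)) (age \<tau> t))
      \<le> (\<integral>\<omega>. stage_cost \<tau> \<mu> t \<omega> \<partial>M) + V k (Suc t)" for k t
  proof -
    have "0 \<le> (\<integral>\<omega>. (input \<tau> \<mu> t \<omega> + gain (value_matrix k) *v estimate \<tau> \<mu> t \<omega>) \<bullet>
            (input_hessian (value_matrix k) *v
              (input \<tau> \<mu> t \<omega> + gain (value_matrix k) *v estimate \<tau> \<mu> t \<omega>)) \<partial>M)"
      by (intro integral_nonneg_AE AE_I2 input_hessian_nonneg positive_semidefinite_value_matrix)
    then show ?thesis
      unfolding V_def using expectation_bellman[OF positive_semidefinite_value_matrix[of k], of t]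
      by simp
  qed
  \<comment> \<open>The inequality \<open>step\<close> is used along \<open>k + t = T - 1\<close>,
    so that the weight always matches the remaining horizon and the \<open>V\<close> terms
    telescope.\<close>
  have "n \<le> T \<Longrightarrow> V T 0 + (\<Sum>t<n. noise_cost (value_matrix (T - Suc t)) +
      estimation_cost A (estimation_weight (value_matrix (T - Suc t))) (age \<tau> t))
      \<le> (\<Sum>t<n. \<integral>\<omega>. stage_cost \<tau> \<mu> t \<omega> \<partial>M) + V (T - n) n" for n
  proof (induction n)
    case 0
    show ?case by simp
  next
    case (Suc n)
    then show ?case using step[of "T - Suc n" n] Suc_diff_Suc[of n T] by simp
  qed
  \<comment> \<open>The terminal term \<open>V 0 T\<close> is zero because
    \<open>value_matrix 0 = 0\<close>.\<close>
  from this[of T] show ?thesis using nonneg[of T 0] by (simp add: V_def)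
qed

text \<open>Replacing the horizon-dependent weights by their limits costs an error that depends only
  on the number of remaining steps and tends to 0 as that number grows. Averaged over the horizon it
  disappears.\<close>

lemma expected_cost_eventually_ge:
  assumes "schedule \<tau>"
  obtains L where "L \<longlonglongrightarrow> optimal_rate \<tau>"
    and "\<And>T. 0 < T \<Longrightarrow> L T \<le> (\<Sum>t<T. \<integral>\<omega>. stage_cost \<tau> \<mu> t \<omega> \<partial>M) / real T"
proof -
  interpret schedule \<tau> by fact
  let ?P = value_limit and ?g = "estimation_cost A (estimation_weight value_limit)"
  let ?gk = "\<lambda>k. estimation_cost A (estimation_weight (value_matrix k))"
  \<comment> \<open>Summing over all ages below the period makes the error uniform in
    \<open>t\<close>.\<close>
  define d where "d k = \<bar>noise_cost (value_matrix k) - noise_cost ?P\<bar>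
    + (\<Sum>a<period. \<bar>?gk k a - ?g a\<bar>)" for k
  \<comment> \<open>The factor \<open>real T / real T\<close> is 1 for positive \<open>T\<close> and
    0 at \<open>T = 0\<close>; hence its limit is obtained from eventual equality.\<close>
  define L where "L T = noise_cost ?P * (real T / real T) + (\<Sum>t<T. ?g (age \<tau> t)) / real T
    - (\<Sum>k<T. d k) / real T" for T
  note psd = positive_semidefinite_estimation_weight[OF positive_semidefinite_value_limit[OF controllable]]
  have "d \<longlonglongrightarrow> \<bar>noise_cost ?P - noise_cost ?P\<bar> + (\<Sum>a<period. \<bar>?g a - ?g a\<bar>)"
    unfolding d_def
    by (intro tendsto_intros value_matrix_tendsto[OF controllable]
        estimation_weight_tendsto[OF controllable])
  then have "d \<longlonglongrightarrow> 0" by simp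
  moreover have "(\<lambda>T. noise_cost ?P * (real T / real T)) \<longlonglongrightarrow> noise_cost ?P"
  proof (rule tendsto_eventually)
    show "\<forall>\<^sub>F T in sequentially. noise_cost ?P * (real T / real T) = noise_cost ?P"
      using eventually_gt_at_top[of 0] by eventually_elim simp
  qed
  ultimately have "L \<longlonglongrightarrow> noise_cost ?P + (\<Sum>k<length \<tau>. \<Sum>a<\<tau> ! k. ?g a) / real period - 0"
    unfolding L_def by (intro tendsto_intros age_average cesaro_tendsto estimation_cost_nonneg[OF psd])
  then have "L \<longlonglongrightarrow> optimal_rate \<tau>" by (simp add: optimal_rate_def)
  moreover have "L T \<le> (\<Sum>t<T. \<integral>\<omega>. stage_cost \<tau> \<mu> t \<omega> \<partial>M) / real T" if "0 < T" for T
  proof -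
    have "noise_cost ?P + ?g (age \<tau> t) - d k \<le> noise_cost (value_matrix k) + ?gk k (age \<tau> t)" for t k
    proof -
      have "\<bar>?gk k (age \<tau> t) - ?g (age \<tau> t)\<bar> \<le> (\<Sum>a<period. \<bar>?gk k a - ?g a\<bar>)"
        using age_less_period by (intro member_le_sum) auto
      then show ?thesis unfolding d_def by linarith
    qed
    then have "(\<Sum>t<T. noise_cost ?P + ?g (age \<tau> t) - d (T - Suc t))
        \<le> (\<Sum>t<T. \<integral>\<omega>. stage_cost \<tau> \<mu> t \<omega> \<partial>M)"
      by (intro order_trans[OF sum_mono expected_cost_ge])
    \<comment> \<open>Time reversal turns the total error into a partial sum of a null sequence,
      ready for the Cesaro mean.\<close>
    moreover have "(\<Sum>t<T. d (T - Suc t)) = (\<Sum>k<T. d k)"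
      by (rule sum.nat_diff_reindex)
    ultimately have "real T * noise_cost ?P + (\<Sum>t<T. ?g (age \<tau> t)) - (\<Sum>k<T. d k)
        \<le> (\<Sum>t<T. \<integral>\<omega>. stage_cost \<tau> \<mu> t \<omega> \<partial>M)"
      by (simp add: sum_subtractf sum.distrib)
    from divide_right_mono[OF this, of "real T"] show ?thesis
      using that by (simp add: L_def add_divide_distrib diff_divide_distrib)
  qed
  ultimately show ?thesis by (rule that)
qed

lemma average_cost_eq:
  "0 < T \<Longrightarrow> average_cost M A B C D x0 w \<tau> \<mu> T
    = ennreal ((\<Sum>t<T. \<integral>\<omega>. stage_cost \<tau> \<mu> t \<omega> \<partial>M) / real T)"
  unfolding average_cost_def
  by (subst nn_integral_eq_integral)
    (auto simp: integrable_stage_cost sum_nonneg divide_ennreal integral_nonneg_AE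
      ennreal_of_nat_eq_real_of_nat)

end

text \<open>The output splits orthogonally and \<open>D\<close> is injective, so the stage cost
  dominates a positive multiple of the squared input, whatever the state does.\<close>

lemma square_integrable_input:
  assumes finite: "(\<integral>\<^sup>+\<omega>. ennreal (\<Sum>t<Suc n. stage_cost \<tau> \<mu> t \<omega>) \<partial>M) < \<infinity>"
  shows "square_integrable (input \<tau> \<mu> n)"
proof -
  have "linear ((*v) D)" by (rule matrix_vector_mul_linear)
  moreover have "inj ((*v) D)"
    using input_injective by (subst linear_injective_0[OF calculation]) force
  ultimately obtain b where b: "0 < b" "\<And>u. b * norm u \<le> norm (D *v u)"
    using linear_inj_bounded_below_pos by blast
  have "(norm (input \<tau> \<mu> n \<omega>))\<^sup>2 * b\<^sup>2 \<le> (\<Sum>t<Suc n. stage_cost \<tau> \<mu> t \<omega>)" for \<omega>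
  proof -
    have "(norm (input \<tau> \<mu> n \<omega>))\<^sup>2 * b\<^sup>2 = (b * norm (input \<tau> \<mu> n \<omega>))\<^sup>2"
      by (simp add: power_mult_distrib)
    also have "\<dots> \<le> (norm (D *v input \<tau> \<mu> n \<omega>))\<^sup>2"
      using b by (intro power_mono) auto
    also have "\<dots> \<le> stage_cost \<tau> \<mu> n \<omega>"
      by (simp add: closed_loop_output_def norm_output)
    also have "\<dots> \<le> (\<Sum>t<Suc n. stage_cost \<tau> \<mu> t \<omega>)" by (simp add: sum_nonneg)
    finally show ?thesis .
  qed
  moreover have "integrable M (\<lambda>\<omega>. \<Sum>t<Suc n. stage_cost \<tau> \<mu> t \<omega>)"
    using finite measurable_stage_cost
    by (intro integrableI_nonneg) (auto intro!: add_nonneg_nonneg sum_nonneg)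
  moreover have "(\<lambda>\<omega>. (norm (input \<tau> \<mu> n \<omega>))\<^sup>2 * b\<^sup>2) \<in> borel_measurable M"
    using measurable_input by measurable
  ultimately have "integrable M (\<lambda>\<omega>. (norm (input \<tau> \<mu> n \<omega>))\<^sup>2 * b\<^sup>2)"
    by (elim Bochner_Integration.integrable_bound) (auto simp: sum_nonneg)
  then show ?thesis
    using b(1) measurable_input by (simp add: square_integrable_def)
qed

text \<open>If some input is not square-integrable, the cost is infinite for all longer horizons and
  so \<open>c\<close> is infinite. Otherwise the expectations may be split and the lower bound
  applies.\<close>

lemma optimal_rate_le:
  assumes "schedule \<tau>" and lim: "average_cost M A B C D x0 w \<tau> \<mu> \<longlonglongrightarrow> c"
  shows "ennreal (optimal_rate \<tau>) \<le> c"
proof (cases "\<forall>t. square_integrable (input \<tau> \<mu> t)")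
  case True
  then obtain L where "L \<longlonglongrightarrow> optimal_rate \<tau>"
    and "\<And>T. 0 < T \<Longrightarrow> L T \<le> (\<Sum>t<T. \<integral>\<omega>. stage_cost \<tau> \<mu> t \<omega> \<partial>M) / real T"
    using expected_cost_eventually_ge[OF _ assms(1)] by metis
  then show ?thesis
    using average_ge_lim[OF lim] average_cost_eq True by (simp add: ennreal_leI)
next
  case False
  then obtain n where n: "\<not> square_integrable (input \<tau> \<mu> n)" by blast
  have infinite: "average_cost M A B C D x0 w \<tau> \<mu> T = \<infinity>" if "n < T" for T
  proof -
    have "(\<integral>\<^sup>+\<omega>. ennreal (\<Sum>t<Suc n. stage_cost \<tau> \<mu> t \<omega>) \<partial>M)
        \<le> (\<integral>\<^sup>+\<omega>. ennreal (\<Sum>t<T. stage_cost \<tau> \<mu> t \<omega>) \<partial>M)"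
      using that by (intro nn_integral_mono ennreal_leI sum_mono2) auto
    moreover have "(\<integral>\<^sup>+\<omega>. ennreal (\<Sum>t<Suc n. stage_cost \<tau> \<mu> t \<omega>) \<partial>M) = \<infinity>"
      using square_integrable_input[of n] n by (metis infinity_ennreal_def less_top)
    ultimately show ?thesis
      by (simp add: average_cost_def top_unique ennreal_top_divide)
  qed
  have "\<forall>\<^sub>F T in sequentially. average_cost M A B C D x0 w \<tau> \<mu> T = \<infinity>"
    using eventually_gt_at_top[of n] by eventually_elim (rule infinite)
  then have "average_cost M A B C D x0 w \<tau> \<mu> \<longlonglongrightarrow> \<infinity>"
    by (rule tendsto_eventually)
  then show ?thesis using LIMSEQ_unique[OF lim] by simp
qed

end

lemma feedback_attains_optimal_rate:
  assumes "schedule \<tau>"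
  defines "\<mu> \<equiv> feedback_policy A B (gain value_limit) \<tau>"
  shows "average_cost M A B C D x0 w \<tau> \<mu> \<longlonglongrightarrow> ennreal (optimal_rate \<tau>)"
proof -
  interpret schedule \<tau> by fact
  let ?P = value_limit and ?g = "estimation_cost A (estimation_weight value_limit)"
  note psd = positive_semidefinite_value_limit[OF controllable]
  have policy: "control_policy \<tau> \<mu>" unfolding \<mu>_def by (rule control_policy_feedback)
  \<comment> \<open>The input is a linear function of the last sampled state. This feeds the strong
    induction for the states below, as that sample is never later than the input.\<close>
  have feedback: "square_integrable (input \<tau> \<mu> t)"
    if "square_integrable (state \<tau> \<mu> (last_sample \<tau> t))" for t
  proof -
    have "square_integrable (\<lambda>\<omega>. ((*v) (A - B ** gain ?P) ^^ a) (state \<tau> \<mu> (last_sample \<tau> t) \<omega>))" for a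
      by (induction a) (auto intro: that square_integrable_matrix)
    moreover have "input \<tau> \<mu> t \<omega> = - (gain ?P *v
        (((*v) (A - B ** gain ?P) ^^ age \<tau> t) (state \<tau> \<mu> (last_sample \<tau> t) \<omega>)))" for \<omega>
      using last_sample_in_observed[of \<tau> t]
      by (simp add: closed_loop_input_def \<mu>_def feedback_policy_def)
    ultimately show ?thesis by (simp add: square_integrable_uminus square_integrable_matrix)
  qed
  have input: "input \<tau> \<mu> t \<omega> = - (gain ?P *v estimate \<tau> \<mu> t \<omega>)" for t \<omega>
    unfolding \<mu>_def by (rule closed_loop_input_feedback)
  have "square_integrable (state \<tau> \<mu> t)" for t
  proof (induction t rule: less_induct)
    case (less t)
    show ?case
    proof (cases t)
      case 0
      then show ?thesis by simp
    next
      case (Suc n)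
      have "square_integrable (state \<tau> \<mu> (last_sample \<tau> n))"
        using less Suc last_sample_le[of \<tau> n] by simp
      then have "square_integrable (input \<tau> \<mu> n)" by (rule feedback)
      then show ?thesis
        using less Suc by (auto simp: closed_loop_state_Suc
            intro!: square_integrable_add square_integrable_matrix square_integrable_noise)
    qed
  qed
  then have inputs: "square_integrable (input \<tau> \<mu> t)" for t by (rule feedback)
  define c where "c T = (\<Sum>t<T. \<integral>\<omega>. stage_cost \<tau> \<mu> t \<omega> \<partial>M)" for T
  define V where "V t = (\<integral>\<omega>. state \<tau> \<mu> t \<omega> \<bullet> (?P *v state \<tau> \<mu> t \<omega>) \<partial>M)" for t
  have V: "0 \<le> V t" for t
    unfolding V_def using psd by (intro integral_nonneg_AE) (auto simp: positive_semidefinite_def)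
  \<comment> \<open>An equality here: the feedback makes the controllable square vanish, and the
    fixed point property of P lets \<open>V\<close> telescope.\<close>
  have "c T + V T = V 0 + real T * noise_cost ?P + (\<Sum>t<T. ?g (age \<tau> t))" for T
  proof (induction T)
    case 0
    show ?case by (simp add: c_def)
  next
    case (Suc T)
    have "(\<integral>\<omega>. stage_cost \<tau> \<mu> T \<omega> \<partial>M) + V (Suc T) = V T + noise_cost ?P + ?g (age \<tau> T)"
      using expectation_bellman[OF policy inputs psd, of T]
      by (simp add: V_def input riccati_value_limit[OF controllable])
    then show ?case using Suc by (simp add: c_def algebra_simps)
  qed
  \<comment> \<open>The terminal term has the favourable sign for an upper bound.\<close>
  then have c: "c T \<le> V 0 + real T * noise_cost ?P + (\<Sum>t<T. ?g (age \<tau> t))" for T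
    using V[of T] by (metis le_add_same_cancel1)
  define U where "U T = V 0 / real T + noise_cost ?P + (\<Sum>t<T. ?g (age \<tau> t)) / real T" for T
  have upper: "c T / real T \<le> U T" if "0 < T" for T
    using divide_right_mono[OF c, of "real T" T] that by (simp add: U_def add_divide_distrib)
  have "U \<longlonglongrightarrow> 0 + noise_cost ?P + (\<Sum>k<length \<tau>. \<Sum>a<\<tau> ! k. ?g a) / real period"
    unfolding U_def using positive_semidefinite_estimation_weight[OF psd]
    by (intro tendsto_intros lim_const_over_n age_average estimation_cost_nonneg)
  then have U: "U \<longlonglongrightarrow> optimal_rate \<tau>" by (simp add: optimal_rate_def)
  obtain L where L: "L \<longlonglongrightarrow> optimal_rate \<tau>" "\<And>T. 0 < T \<Longrightarrow> L T \<le> c T / real T"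
    using expected_cost_eventually_ge[OF policy inputs assms(1)] unfolding c_def by metis
  \<comment> \<open>Only policies whose average converges compete, so the upper bound is combined
    with the general lower bound to obtain an actual limit.\<close>
  have "(\<lambda>T. c T / real T) \<longlonglongrightarrow> optimal_rate \<tau>"
    by (rule tendsto_sandwich[OF _ _ L(1) U])
      (use L(2) upper in \<open>auto intro: eventually_mono[OF eventually_gt_at_top[of 0]]\<close>)
  then have "(\<lambda>T. ennreal (c T / real T)) \<longlonglongrightarrow> ennreal (optimal_rate \<tau>)"
    by (rule tendsto_ennrealI)
  moreover have "\<forall>\<^sub>F T in sequentially.
      ennreal (c T / real T) = average_cost M A B C D x0 w \<tau> \<mu> T"
    using eventually_gt_at_top[of 0]
    by eventually_elim (simp add: c_def average_cost_eq[OF policy inputs])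
  ultimately show ?thesis by (rule Lim_transform_eventually)
qed

lemma J\<^sub>2_eq_optimal_rate:
  assumes "schedule \<tau>"
  shows "J\<^sub>2 M A B C D x0 w \<tau> = ennreal (optimal_rate \<tau>)"
  unfolding J\<^sub>2_def
proof (rule antisym)
  show "Inf {c. \<exists>\<mu>. control_policy \<tau> \<mu> \<and> average_cost M A B C D x0 w \<tau> \<mu> \<longlonglongrightarrow> c}
      \<le> ennreal (optimal_rate \<tau>)"
    using feedback_attains_optimal_rate[OF assms] control_policy_feedback
    by (intro Inf_lower) blast
  show "ennreal (optimal_rate \<tau>)
      \<le> Inf {c. \<exists>\<mu>. control_policy \<tau> \<mu> \<and> average_cost M A B C D x0 w \<tau> \<mu> \<longlonglongrightarrow> c}"
    using optimal_rate_le[OF _ assms] by (intro Inf_greatest) blast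
qed

end

section \<open>Shifting length between two intervals of a schedule\<close>

lemma sum_exchange_entries:
  fixes f :: "nat \<Rightarrow> 'b::comm_monoid_add"
  assumes "i < j" "l < j" "i \<noteq> l"
    and "\<forall>k<j. \<tau>' ! k = (if k = i then a else if k = l then b else \<tau> ! k)"
  obtains r where "(\<Sum>k<j. f (\<tau> ! k)) = f (\<tau> ! i) + f (\<tau> ! l) + r"
    and "(\<Sum>k<j. f (\<tau>' ! k)) = f a + f b + r"
proof
  have split: "(\<Sum>k<j. h k) = h i + h l + (\<Sum>k\<in>{..<j} - {i, l}. h k)" for h :: "nat \<Rightarrow> 'b"
  proof -
    have "(\<Sum>k<j. h k) = h i + (h l + (\<Sum>k\<in>{..<j} - {i} - {l}. h k))"
      using assms by (simp add: sum.remove[of "{..<j}" i] sum.remove[of "{..<j} - {i}" l])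
    also have "{..<j} - {i} - {l} = {..<j} - {i, l}" by auto
    finally show ?thesis by (simp add: add.assoc)
  qed
  show "(\<Sum>k<j. f (\<tau> ! k)) = f (\<tau> ! i) + f (\<tau> ! l) + (\<Sum>k\<in>{..<j} - {i, l}. f (\<tau> ! k))"
    by (rule split)
  have "(\<Sum>k\<in>{..<j} - {i, l}. f (\<tau>' ! k)) = (\<Sum>k\<in>{..<j} - {i, l}. f (\<tau> ! k))"
    using assms(4) by (intro sum.cong) auto
  then show "(\<Sum>k<j. f (\<tau>' ! k)) = f a + f b + (\<Sum>k\<in>{..<j} - {i, l}. f (\<tau> ! k))"
    using assms split[of "\<lambda>k. f (\<tau>' ! k)"] by simp
qed

theorem theorem2:
  fixes M :: "'a measure"
    and A :: "real^'n^'n" and B :: "real^'m^'n" and C\<^sub>2 :: "real^'n^'k" and D\<^sub>2\<^sub>1 :: "real^'m^'k"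
    and x0 :: "real^'n" and w :: "nat \<Rightarrow> 'a \<Rightarrow> real^'n" and W :: "real^'n^'n"
    and \<tau> \<tau>' :: "nat list" and h j i l p :: nat
  assumes "transpose C\<^sub>2 ** D\<^sub>2\<^sub>1 = 0"
    and "positive_definite (transpose D\<^sub>2\<^sub>1 ** D\<^sub>2\<^sub>1)"
    and "controllable A B"
    and "observable A C\<^sub>2"
    and "prob_space M"
    and "prob_space.indep_vars M (\<lambda>_. borel) w UNIV"
    and "\<And>t. distr M borel (w t) = distr M borel (w 0)"
    and "\<And>t. has_bochner_integral M (w t) 0"
    and "\<And>t. has_bochner_integral M (\<lambda>\<omega>. \<chi> a b. w t \<omega> $ a * w t \<omega> $ b) W"
    and "positive_semidefinite W"
    and "length \<tau> = j" and "\<forall>k<j. 0 < \<tau> ! k" and "(\<Sum>k<j. \<tau> ! k) = h"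
    and "i < j" and "l < j" and "\<tau> ! l < \<tau> ! i"
    and "p \<le> (\<tau> ! i - \<tau> ! l) div 2"
    and "length \<tau>' = j"
    and "\<forall>k<j. \<tau>' ! k = (if k = i then \<tau> ! i - p else if k = l then \<tau> ! l + p else \<tau> ! k)"
  shows "J\<^sub>2 M A B C\<^sub>2 D\<^sub>2\<^sub>1 x0 w \<tau>' \<le> J\<^sub>2 M A B C\<^sub>2 D\<^sub>2\<^sub>1 x0 w \<tau>"
proof -
  interpret prob_space M by fact
  interpret lq_control A B C\<^sub>2 D\<^sub>2\<^sub>1 M w W x0
    by unfold_locales (use assms in auto)
  let ?g = "estimation_cost A (estimation_weight value_limit)"
  have ne: "i \<noteq> l" using assms(16) by auto
  \<comment> \<open>The shortened interval stays positive, since the bound on \<open>p\<close> gives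
    \<open>\<tau> ! i - p \<ge> \<tau> ! l + p\<close>.\<close>
  have sched: "schedule \<tau>" "schedule \<tau>'"
    using assms(11,12,14-19) by (unfold_locales; auto)+
  \<comment> \<open>The exchange is applied twice with a common remainder: to the lengths, which
    shows that the period is unchanged, and then to the penalties.\<close>
  obtain r where "(\<Sum>k<j. \<tau> ! k) = \<tau> ! i + \<tau> ! l + r"
    and "(\<Sum>k<j. \<tau>' ! k) = (\<tau> ! i - p) + (\<tau> ! l + p) + r"
    using sum_exchange_entries[where f = "\<lambda>n. n", OF assms(14,15) ne assms(19)] by blast
  then have "(\<Sum>k<j. \<tau>' ! k) = (\<Sum>k<j. \<tau> ! k)" using assms(17) by simp
  then have period: "schedule.period \<tau>' = schedule.period \<tau>"
    by (simp add: schedule.period_def sched assms(11,18))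
  obtain s where s: "(\<Sum>k<j. \<Sum>a<\<tau> ! k. ?g a) = (\<Sum>a<\<tau> ! i. ?g a) + (\<Sum>a<\<tau> ! l. ?g a) + s"
    "(\<Sum>k<j. \<Sum>a<\<tau>' ! k. ?g a) = (\<Sum>a<\<tau> ! i - p. ?g a) + (\<Sum>a<\<tau> ! l + p. ?g a) + s"
    using sum_exchange_entries[where f = "\<lambda>n. \<Sum>a<n. ?g a", OF assms(14,15) ne assms(19)] by blast
  have "(\<Sum>k<j. \<Sum>a<\<tau>' ! k. ?g a) \<le> (\<Sum>k<j. \<Sum>a<\<tau> ! k. ?g a)"
    unfolding s using assms(3,16,17)
    by (intro add_right_mono sum_exchange_le estimation_cost_mono
        positive_semidefinite_estimation_weight positive_semidefinite_value_limit)
  then have "optimal_rate \<tau>' \<le> optimal_rate \<tau>"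
    unfolding optimal_rate_def period assms(11,18)
    by (intro add_left_mono divide_right_mono) auto
  then show ?thesis by (simp add: J\<^sub>2_eq_optimal_rate sched ennreal_leI)
qed

end
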